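(* Let $\mathcal{I}$ be any one of $\mathcal{P}$, $\mathcal{P}_\infty$, $\mathcal{B}$. For every $0<\delta\le2$, the isometry class $\{\mu\in\mathcal{I}: X_\mu$ has the LD$\delta$P$\}$ is $G_\delta$-complete in $\mathcal{I}$.
   Context: Coding: $V$ is the set of finitely supported rational sequences; $\mathcal{P}\subset\mathbb{R}^V$ the seminorms on $V$ with pointwise convergence topology; for $\mu\in\mathcal{P}$, $\bar\mu$ is its seminorm extension to $c_{00}$ and $X_\mu$ the completion of $c_{00}/\{\bar\mu=0\}$; $\mathcal{P}_\infty=\{\mu:\dim X_\mu=\infty\}$, $\mathcal{B}=\{\mu\in\mathcal{P}_\infty:\bar\mu$ a norm on $c_{00}\}$, subspace topologies. A Banach space has the LD$\delta$P if every slice $\{x\in B_X:f(x)>1-\alpha\}$ ($f\in S_{X^*}$, $\alpha>0$) of $B_X$ has diameter $\ge\delta$. A set $A$ in a Polish space $Z$ is $G_\delta$-complete if it is $G_\delta$ and every $G_\delta$ subset of every zero-dimensional Polish space is a continuous preimage of $A$. *)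

theory Defs
  imports "HOL-Analysis.Analysis" "HOL-Library.Poly_Mapping"
begin

text \<open>V is the type nat =>0 rat (finitely supported functions nat \<Rightarrow> rat).
  R^V is the function type V \<Rightarrow> real, carrying the product
  topology (topology of pointwise convergence) from HOL-Analysis.Function_Topology.\<close>

type_synonym V = "nat \<Rightarrow>\<^sub>0 rat"

definition qscale :: "rat \<Rightarrow> V \<Rightarrow> V" where
  "qscale q v = Abs_poly_mapping (\<lambda>n. q * Poly_Mapping.lookup v n)"

definition seminormV :: "(V \<Rightarrow> real) \<Rightarrow> bool" where
  "seminormV \<mu> \<longleftrightarrow> (\<forall>v. 0 \<le> \<mu> v)
      \<and> (\<forall>v w. \<mu> (v + w) \<le> \<mu> v + \<mu> w)
      \<and> (\<forall>q v. \<mu> (qscale q v) = \<bar>of_rat q\<bar> * \<mu> v)"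

definition Pset :: "(V \<Rightarrow> real) set" where
  "Pset = {\<mu>. seminormV \<mu>}"

definition c00 :: "(nat \<Rightarrow> real) set" where
  "c00 = {x. finite {n. x n \<noteq> 0}}"

definition rnd :: "nat \<Rightarrow> (nat \<Rightarrow> real) \<Rightarrow> V" where
  "rnd k x = Abs_poly_mapping (\<lambda>n. of_int \<lfloor>x n * real (Suc k)\<rfloor> / of_nat (Suc k))"

text \<open>The (unique, continuous) seminorm extension \<mu>bar of \<mu> to c00, obtained as
  the limit of \<mu> along rational approximations.\<close>
definition mubar :: "(V \<Rightarrow> real) \<Rightarrow> (nat \<Rightarrow> real) \<Rightarrow> real" where
  "mubar \<mu> x = lim (\<lambda>k. \<mu> (rnd k x))"

text \<open>Elements of X_mu are represented by mubar-Cauchy sequences in c00; two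
  representatives are identified when the seminorm of their difference is 0.\<close>
definition Xc :: "(V \<Rightarrow> real) \<Rightarrow> (nat \<Rightarrow> nat \<Rightarrow> real) set" where
  "Xc \<mu> = {s. (\<forall>k. s k \<in> c00) \<and>
     (\<forall>e>0. \<exists>N. \<forall>m\<ge>N. \<forall>n\<ge>N. mubar \<mu> (\<lambda>i. s m i - s n i) < e)}"

definition Xn :: "(V \<Rightarrow> real) \<Rightarrow> (nat \<Rightarrow> nat \<Rightarrow> real) \<Rightarrow> real" where
  "Xn \<mu> s = lim (\<lambda>k. mubar \<mu> (s k))"

definition infdimX :: "(V \<Rightarrow> real) \<Rightarrow> bool" where
  "infdimX \<mu> \<longleftrightarrow> (\<forall>n. \<exists>s :: nat \<Rightarrow> nat \<Rightarrow> nat \<Rightarrow> real. (\<forall>i<n. s i \<in> Xc \<mu>) \<and>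
      (\<forall>c :: nat \<Rightarrow> real. Xn \<mu> (\<lambda>k j. \<Sum>i<n. c i * s i k j) = 0 \<longrightarrow> (\<forall>i<n. c i = 0)))"

definition Pinf :: "(V \<Rightarrow> real) set" where
  "Pinf = {\<mu> \<in> Pset. infdimX \<mu>}"

definition Bset :: "(V \<Rightarrow> real) set" where
  "Bset = {\<mu> \<in> Pinf. \<forall>x\<in>c00. mubar \<mu> x = 0 \<longrightarrow> x = (\<lambda>_. 0)}"

text \<open>f is an element of the unit sphere of the dual of X_mu: a linear, bounded
  functional on X_mu (boundedness forces compatibility with the identification of
  representatives) whose norm is 1.\<close>
definition dual_sphere :: "(V \<Rightarrow> real) \<Rightarrow> ((nat \<Rightarrow> nat \<Rightarrow> real) \<Rightarrow> real) \<Rightarrow> bool" where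
  "dual_sphere \<mu> f \<longleftrightarrow>
     (\<forall>s\<in>Xc \<mu>. \<forall>t\<in>Xc \<mu>. f (\<lambda>k j. s k j + t k j) = f s + f t)
   \<and> (\<forall>a. \<forall>s\<in>Xc \<mu>. f (\<lambda>k j. a * s k j) = a * f s)
   \<and> (\<exists>C. \<forall>s\<in>Xc \<mu>. \<bar>f s\<bar> \<le> C * Xn \<mu> s)
   \<and> (SUP s\<in>{s\<in>Xc \<mu>. Xn \<mu> s \<le> 1}. \<bar>f s\<bar>) = 1"

definition slice :: "(V \<Rightarrow> real) \<Rightarrow> ((nat \<Rightarrow> nat \<Rightarrow> real) \<Rightarrow> real) \<Rightarrow> real
    \<Rightarrow> (nat \<Rightarrow> nat \<Rightarrow> real) set" where
  "slice \<mu> f \<alpha> = {s\<in>Xc \<mu>. Xn \<mu> s \<le> 1 \<and> f s > 1 - \<alpha>}"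

definition LDP :: "real \<Rightarrow> (V \<Rightarrow> real) \<Rightarrow> bool" where
  "LDP \<delta> \<mu> \<longleftrightarrow> (\<forall>f \<alpha>. dual_sphere \<mu> f \<and> \<alpha> > 0 \<longrightarrow>
      (SUP p\<in>slice \<mu> f \<alpha> \<times> slice \<mu> f \<alpha>. Xn \<mu> (\<lambda>k j. fst p k j - snd p k j)) \<ge> \<delta>)"

definition Polish_top :: "'a topology \<Rightarrow> bool" where
  "Polish_top W \<longleftrightarrow> completely_metrizable_space W \<and> separable_space W"

definition Gdelta_complete :: "'w itself \<Rightarrow> 'z topology \<Rightarrow> 'z set \<Rightarrow> bool" where
  "Gdelta_complete _ Z A \<longleftrightarrow> gdelta_in Z A \<and>
     (\<forall>W :: 'w topology. Polish_top W \<and> W dim_le 0 \<longrightarrow>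
        (\<forall>C. gdelta_in W C \<longrightarrow>
           (\<exists>g. continuous_map W Z g \<and> C = {w \<in> topspace W. g w \<in> A})))"

end

theory Submission
  imports Defs "HOL-Library.Nat_Bijection"
begin

text \<open>
  The bound on the class: by a Hahn--Banach separation, the LD\<open>\<delta>\<close>P says that for every
  \<open>c < \<delta>\<close> the unit ball is contained in the closed convex hull of the midpoints of pairs in the
  ball at distance greater than \<open>c\<close>. By density it suffices to take rational \<open>c\<close> and to approximate
  each of the countably many \<open>v \<in> V\<close> to each precision \<open>1 / n\<close> by convex combinations of such
  midpoints from \<open>V\<close>, and the existence of one such combination is an open condition on \<open>\<mu>\<close>.

  Hardness: split the coordinates into infinitely many infinite blocks, let \<open>w i\<close> be positive
  weights tending to zero, and for \<open>t = (t n) \<ge> 0\<close> let \<open>N t\<close> be the sum over \<open>n\<close> of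
  \<open>max (\<Sum>i\<in>block n. w i * \<bar>x i\<bar>) (t n * sup i\<in>block n. \<bar>x i\<bar>)\<close>. This is always a norm on
  \<open>c00\<close>. If \<open>t n > 0\<close> and \<open>x\<close> lives on block \<open>n\<close> with norm less than 1, then adding or subtracting
  nearly \<open>e i / t n\<close> with \<open>i\<close> far out in the block stays in the ball, so slices have diameter 2.
  If \<open>t n = 0\<close>, every \<open>e i\<close> with \<open>i\<close> in block \<open>n\<close> spans an \<open>l1\<close>-summand, and the slices of its
  coordinate functional are arbitrarily small. A G-delta set in a metrizable space has the form
  \<open>{x. \<forall>n. h n x > 0}\<close> with continuous \<open>h n \<ge> 0\<close>, and \<open>x \<mapsto> N (h n x)\<close> is the required
  reduction.
\<close>

subsection \<open>A Hahn--Banach theorem for abelian groups\<close>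

text \<open>Additivity under doubling is all the homogeneity that the Hahn--Banach argument needs,
  so no scalars are required.\<close>

definition sublinear :: "('a::ab_group_add \<Rightarrow> real) \<Rightarrow> bool" where
  "sublinear p \<longleftrightarrow> (\<forall>x y. p (x + y) \<le> p x + p y) \<and> (\<forall>x. p (x + x) = 2 * p x)"

lemma sublinear_add: "sublinear p \<Longrightarrow> p (x + y) \<le> p x + p y"
  and sublinear_double: "sublinear p \<Longrightarrow> p (x + x) = 2 * p x"
  by (simp_all add: sublinear_def)

lemma sublinearI:
  assumes "\<And>x y. p (x + y) \<le> p x + p y" and "\<And>x. 2 * p x \<le> p (x + x)"
  shows "sublinear p"
  unfolding sublinear_def using assms by (metis antisym mult_2)

lemma sublinear_0: "sublinear p \<Longrightarrow> p 0 = 0"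
  using sublinear_double[of p 0] by simp

lemma sublinear_minus: "sublinear p \<Longrightarrow> - p (- x) \<le> p x"
  using sublinear_add[of p x "- x"] sublinear_0[of p] by simp

lemma sublinear_directional_minorant:
  fixes p :: "'a::ab_group_add \<Rightarrow> real"
  assumes p: "sublinear p"
  obtains q where "sublinear q" "q \<le> p" "\<And>x. q x \<le> p (x + w) - p w"
proof -
  define D where "D n = ((\<lambda>u. u + u) ^^ n) w" for n
  have D_0: "D 0 = w" and D_Suc: "D (Suc n) = D n + D n" for n
    by (simp_all add: D_def)
  have p_D: "p (D n) = 2 ^ n * p w" for n
    by (induction n) (simp_all add: D_0 D_Suc sublinear_double[OF p])
  define a where "a x n = p (x + D n) - 2 ^ n * p w" for x n
  have a_add: "a (x + y) (Suc n) \<le> a x n + a y n" for x y n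
    using sublinear_add[OF p, of "x + D n" "y + D n"] by (simp add: a_def D_Suc ac_simps)
  have a_double: "a (x + x) (Suc n) = 2 * a x n" for x n
    using sublinear_double[OF p, of "x + D n"] by (simp add: a_def D_Suc ac_simps)
  have a_le: "a x n \<le> p x" for x n
    using sublinear_add[OF p, of x "D n"] by (simp add: a_def p_D)
  have a_Suc_le: "a x (Suc n) \<le> a x n" for x n
    using sublinear_add[OF p, of "x + D n" "D n"] by (simp add: a_def D_Suc p_D ac_simps)
  have a_ge: "- p (- x) \<le> a x n" for x n
    using sublinear_add[OF p, of "x + D n" "- x"] by (simp add: a_def p_D)
  have "\<exists>l. a x \<longlonglongrightarrow> l \<and> (\<forall>n. l \<le> a x n)" for x
    using decseq_convergent[of "a x" "- p (- x)"] a_Suc_le a_ge by (metis decseq_SucI)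
  then obtain q where a_lim: "\<And>x. a x \<longlonglongrightarrow> q x" and q_le: "\<And>x n. q x \<le> a x n"
    by metis
  have "q (x + y) \<le> q x + q y" for x y
    by (rule LIMSEQ_le[OF LIMSEQ_Suc[OF a_lim] tendsto_add[OF a_lim a_lim]]) (simp add: a_add)
  moreover have "2 * q x \<le> q (x + x)" for x
    by (rule LIMSEQ_le[OF tendsto_mult_left[OF a_lim] LIMSEQ_Suc[OF a_lim]]) (simp add: a_double)
  ultimately have "sublinear q" by (rule sublinearI)
  moreover have "q \<le> p" using order_trans[OF q_le a_le] by (simp add: le_fun_def)
  moreover have "q x \<le> p (x + w) - p w" for x using q_le[of x 0] by (simp add: a_def D_0)
  ultimately show ?thesis by (rule that)
qed

lemma sublinear_INF_chain:
  fixes C :: "('a::ab_group_add \<Rightarrow> real) set"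
  assumes nonempty: "C \<noteq> {}" and sublinear: "\<And>p. p \<in> C \<Longrightarrow> sublinear p"
    and below: "\<And>p. p \<in> C \<Longrightarrow> p \<le> p0"
    and chain: "\<And>p q. p \<in> C \<Longrightarrow> q \<in> C \<Longrightarrow> p \<le> q \<or> q \<le> p"
  shows "sublinear (\<lambda>x. INF p\<in>C. p x)" and "q \<in> C \<Longrightarrow> (\<lambda>x. INF p\<in>C. p x) \<le> q"
proof -
  have "- p0 (- x) \<le> p x" if "p \<in> C" for p x
    using sublinear_minus[OF sublinear[OF that], of x] le_funD[OF below[OF that], of "- x"] by simp
  then have bdd: "bdd_below ((\<lambda>p. p x) ` C)" for x
    by (rule bdd_belowI2)
  have INF_le: "(INF p\<in>C. p x) \<le> q x" if "q \<in> C" for q x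
    by (rule cINF_lower[OF bdd that])
  show "(\<lambda>x. INF p\<in>C. p x) \<le> q" if "q \<in> C"
    using INF_le[OF that] by (simp add: le_fun_def)
  have INF_add: "(INF p\<in>C. p (x + y)) \<le> (INF p\<in>C. p x) + (INF p\<in>C. p y)" for x y
  proof -
    have "(INF p\<in>C. p (x + y)) - q y \<le> p x" if pq: "p \<in> C" "q \<in> C" for p q
    proof -
      obtain m where m: "m \<in> C" "m \<le> p" "m \<le> q"
        using chain[OF pq] pq by blast
      have "(INF p\<in>C. p (x + y)) \<le> m x + m y"
        using INF_le[OF m(1)] sublinear_add[OF sublinear[OF m(1)]] by (rule order_trans)
      then show ?thesis
        using le_funD[OF m(2), of x] le_funD[OF m(3), of y] by linarith
    qed
    then have "(INF p\<in>C. p (x + y)) - q y \<le> (INF p\<in>C. p x)" if "q \<in> C" for q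
      using that by (intro cINF_greatest[OF nonempty])
    then have "(INF p\<in>C. p (x + y)) - (INF p\<in>C. p x) \<le> (INF p\<in>C. p y)"
      by (intro cINF_greatest[OF nonempty]) (simp add: algebra_simps)
    then show ?thesis by linarith
  qed
  have "2 * (INF p\<in>C. p x) \<le> (INF p\<in>C. p (x + x))" for x
    by (intro cINF_greatest[OF nonempty]) (simp add: INF_le sublinear sublinear_double)
  with INF_add show "sublinear (\<lambda>x. INF p\<in>C. p x)"
    by (rule sublinearI)
qed

lemma minimal_sublinear_below:
  fixes p :: "'a::ab_group_add \<Rightarrow> real"
  assumes p: "sublinear p"
  obtains f where "sublinear f" "f \<le> p" "\<And>q. sublinear q \<Longrightarrow> q \<le> f \<Longrightarrow> q = f"
proof -
  define S where "S = {q. sublinear q \<and> q \<le> p}"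
  have "\<exists>f\<in>S. \<forall>q\<in>S. f \<ge> q \<longrightarrow> q = f"
  proof (rule predicate_Zorn)
    show "partial_order_on S (relation_of (\<ge>) S)"
      by (rule partial_order_on_relation_ofI) auto
    fix C assume C: "C \<in> Chains (relation_of (\<ge>) S)"
    show "\<exists>u\<in>S. \<forall>q\<in>C. q \<ge> u"
    proof (cases "C = {}")
      case True
      then show ?thesis using p by (auto simp: S_def)
    next
      case False
      have C_S: "sublinear q" "q \<le> p" if "q \<in> C" for q
        using C that by (auto simp: Chains_def relation_of_def S_def)
      have C_chain: "q \<le> r \<or> r \<le> q" if "q \<in> C" "r \<in> C" for q r
        using C that by (auto simp: Chains_def relation_of_def)
      note INF = sublinear_INF_chain[OF False C_S C_chain]
      have "(\<lambda>x. INF q\<in>C. q x) \<le> p"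
        using False INF(2) C_S(2) by (blast intro: order_trans)
      then show ?thesis using INF unfolding S_def by blast
    qed
  qed
  then show ?thesis using that unfolding S_def by (auto intro: order_trans)
qed

lemma additive_if_minimal_sublinear:
  assumes f: "sublinear f" and minimal: "\<And>q. sublinear q \<Longrightarrow> q \<le> f \<Longrightarrow> q = f"
  shows "Modules.additive f"
proof
  fix x y
  obtain q where q: "sublinear q" "q \<le> f" "\<And>x. q x \<le> f (x + y) - f y"
    using sublinear_directional_minorant[OF f] by blast
  have "q = f" using minimal q(1,2) by blast
  then show "f (x + y) = f x + f y"
    using q(3)[of x] sublinear_add[OF f, of x y] by simp
qed

theorem Hahn_Banach_group:
  fixes p :: "'a::ab_group_add \<Rightarrow> real"
  assumes p: "sublinear p"
  obtains f where "Modules.additive f" "f \<le> p" "f x = p x"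
proof -
  obtain q where q: "sublinear q" "q \<le> p" "\<And>y. q y \<le> p (y + x) - p x"
    using sublinear_directional_minorant[OF p] by blast
  obtain f where f: "sublinear f" "f \<le> q" "\<And>r. sublinear r \<Longrightarrow> r \<le> f \<Longrightarrow> r = f"
    using minimal_sublinear_below[OF q(1)] by blast
  have additive: "Modules.additive f"
    using f(1,3) by (rule additive_if_minimal_sublinear)
  have f_le: "f \<le> p"
    using f(2) q(2) by (rule order_trans)
  have "- f x \<le> - p x"
    using le_funD[OF f(2), of "- x"] q(3)[of "- x"]
    by (simp add: additive.minus[OF additive] sublinear_0[OF p])
  then have "f x = p x"
    using le_funD[OF f_le, of x] by simp
  with additive f_le show ?thesis by (rule that)
qed

subsection \<open>Extension of seminorms and functionals to the completion\<close>

abbreviation lookup :: "V \<Rightarrow> nat \<Rightarrow> rat" where "lookup \<equiv> Poly_Mapping.lookup"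
abbreviation keys :: "V \<Rightarrow> nat set" where "keys \<equiv> Poly_Mapping.keys"
abbreviation single :: "nat \<Rightarrow> rat \<Rightarrow> V" where "single \<equiv> Poly_Mapping.single"

lemma lookup_qscale [simp]: "lookup (qscale q v) i = q * lookup v i"
proof -
  have "finite {i. q * lookup v i \<noteq> 0}"
    by (rule finite_subset[OF _ finite_lookup[of v]]) auto
  then show ?thesis by (simp add: qscale_def)
qed

lemma keys_qscale: "keys (qscale q v) \<subseteq> keys v"
  by (auto simp: in_keys_iff)

lemma qscale_zero_left: "qscale 0 v = 0"
  and qscale_zero_right: "qscale q 0 = 0"
  and qscale_one: "qscale 1 v = v"
  and qscale_minus_one: "qscale (-1) v = - v"
  and qscale_qscale: "qscale p (qscale q v) = qscale (p * q) v"
  and qscale_add_left: "qscale (p + q) v = qscale p v + qscale q v"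
  and qscale_add_right: "qscale q (v + w) = qscale q v + qscale q w"
  and qscale_diff_right: "qscale q (v - w) = qscale q v - qscale q w"
  by (auto intro!: poly_mapping_eqI simp: lookup_add lookup_minus algebra_simps)

definition emb :: "V \<Rightarrow> nat \<Rightarrow> real" where
  "emb v = (\<lambda>i. of_rat (lookup v i))"

lemma emb_zero: "emb 0 = (\<lambda>_. 0)"
  and emb_add: "emb (v + w) = (\<lambda>i. emb v i + emb w i)"
  and emb_diff: "emb (v - w) = (\<lambda>i. emb v i - emb w i)"
  and emb_qscale: "emb (qscale q v) = (\<lambda>i. of_rat q * emb v i)"
  and emb_single: "emb (single i p) = (\<lambda>j. if j = i then of_rat p else 0)"
  by (auto simp: emb_def lookup_add lookup_minus lookup_single of_rat_add of_rat_diff of_rat_mult)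

lemma emb_eq_0_iff: "emb v i = 0 \<longleftrightarrow> i \<notin> keys v"
  by (simp add: emb_def in_keys_iff)

lemma emb_c00 [simp]: "emb v \<in> c00"
  by (simp add: c00_def emb_eq_0_iff)

lemma c00_pointwise:
  assumes "x \<in> c00" "y \<in> c00" "\<And>i. x i = 0 \<Longrightarrow> y i = 0 \<Longrightarrow> z i = 0"
  shows "z \<in> c00"
proof -
  have "{i. z i \<noteq> 0} \<subseteq> {i. x i \<noteq> 0} \<union> {i. y i \<noteq> 0}" using assms(3) by blast
  then show ?thesis using assms(1,2) by (simp add: c00_def finite_subset)
qed

lemma c00_add: "x \<in> c00 \<Longrightarrow> y \<in> c00 \<Longrightarrow> (\<lambda>i. x i + y i) \<in> c00"
  by (rule c00_pointwise[of x y]) simp_all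

lemma c00_diff: "x \<in> c00 \<Longrightarrow> y \<in> c00 \<Longrightarrow> (\<lambda>i. x i - y i) \<in> c00"
  by (rule c00_pointwise[of x y]) simp_all

lemma c00_scale: "x \<in> c00 \<Longrightarrow> (\<lambda>i. a * x i) \<in> c00"
  by (rule c00_pointwise[of x x]) simp_all

definition rat_approx :: "real \<Rightarrow> nat \<Rightarrow> rat" where
  "rat_approx a k = of_int \<lfloor>a * real (Suc k)\<rfloor> / of_nat (Suc k)"

lemma rat_approx_tendsto: "(\<lambda>k. real_of_rat (rat_approx a k)) \<longlonglongrightarrow> a"
proof -
  have rat_approx_eq: "real_of_rat (rat_approx a k) = \<lfloor>a * real (Suc k)\<rfloor> / real (Suc k)" for k
    unfolding rat_approx_def of_rat_divide of_rat_of_nat_eq of_rat_of_int_eq ..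
  have "(a * real (Suc k) - 1) / real (Suc k) \<le> real_of_rat (rat_approx a k)" for k
    unfolding rat_approx_eq by (intro divide_right_mono) linarith+
  then have lower: "a - 1 / real (Suc k) \<le> real_of_rat (rat_approx a k)" for k
    by (simp add: diff_divide_distrib del: of_nat_Suc)
  have upper: "real_of_rat (rat_approx a k) \<le> a" for k
    unfolding rat_approx_eq by (simp add: pos_divide_le_eq del: of_nat_Suc)
  have "(\<lambda>k. a - 1 / real (Suc k)) \<longlonglongrightarrow> a - 0"
    by (rule tendsto_diff[OF tendsto_const LIMSEQ_Suc[OF lim_1_over_n]])
  then have "(\<lambda>k. a - 1 / real (Suc k)) \<longlonglongrightarrow> a" by simp
  then show ?thesis
    by (rule tendsto_sandwich[OF _ _ _ tendsto_const, rotated 2])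
      (use lower upper in \<open>blast intro: always_eventually\<close>)+
qed

lemma lookup_rnd:
  assumes "x \<in> c00"
  shows "lookup (rnd k x) i = rat_approx (x i) k"
proof -
  have "finite {i. rat_approx (x i) k \<noteq> 0}"
    by (rule finite_subset[of _ "{i. x i \<noteq> 0}"]) (use assms in \<open>auto simp: c00_def rat_approx_def\<close>)
  then show ?thesis by (simp add: rnd_def rat_approx_def)
qed

lemma keys_rnd: "x \<in> c00 \<Longrightarrow> keys (rnd k x) \<subseteq> {i. x i \<noteq> 0}"
  by (auto simp: in_keys_iff lookup_rnd rat_approx_def)

definition c00_tendsto :: "(nat \<Rightarrow> V) \<Rightarrow> (nat \<Rightarrow> real) \<Rightarrow> bool" where
  "c00_tendsto v x \<longleftrightarrow>
     (\<exists>K. finite K \<and> (\<forall>k. keys (v k) \<subseteq> K)) \<and> (\<forall>i. (\<lambda>k. emb (v k) i) \<longlonglongrightarrow> x i)"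

lemma c00_tendsto_rnd: "x \<in> c00 \<Longrightarrow> c00_tendsto (\<lambda>k. rnd k x) x"
  unfolding c00_tendsto_def using keys_rnd[of x] rat_approx_tendsto
  by (auto simp: c00_def emb_def lookup_rnd)

lemma c00_tendsto_emb: "c00_tendsto (\<lambda>k. v) (emb v)"
  unfolding c00_tendsto_def using finite_keys[of v] by (intro conjI exI[of _ "keys v"]) simp_all

lemma c00_tendsto_add:
  assumes "c00_tendsto v x" "c00_tendsto w y"
  shows "c00_tendsto (\<lambda>k. v k + w k) (\<lambda>i. x i + y i)"
proof -
  obtain K L where "finite K" "\<And>k. keys (v k) \<subseteq> K" "finite L" "\<And>k. keys (w k) \<subseteq> L"
    using assms by (auto simp: c00_tendsto_def)
  then have "finite (K \<union> L)" "keys (v k + w k) \<subseteq> K \<union> L" for k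
    using keys_add[of "v k" "w k"] by blast+
  then have "\<exists>K. finite K \<and> (\<forall>k. keys (v k + w k) \<subseteq> K)" by blast
  then show ?thesis using assms by (simp add: c00_tendsto_def emb_add tendsto_add)
qed

lemma c00_tendsto_qscale:
  assumes "c00_tendsto v x" "(\<lambda>k. real_of_rat (q k)) \<longlonglongrightarrow> a"
  shows "c00_tendsto (\<lambda>k. qscale (q k) (v k)) (\<lambda>i. a * x i)"
proof -
  have "\<exists>K. finite K \<and> (\<forall>k. keys (qscale (q k) (v k)) \<subseteq> K)"
    using assms(1) keys_qscale unfolding c00_tendsto_def by (meson order_trans)
  then show ?thesis using assms by (simp add: c00_tendsto_def emb_qscale tendsto_mult)
qed

lemma c00_tendsto_diff:
  assumes "c00_tendsto v x" "c00_tendsto w y"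
  shows "c00_tendsto (\<lambda>k. v k - w k) (\<lambda>i. x i - y i)"
  using c00_tendsto_add[OF assms(1) c00_tendsto_qscale[OF assms(2), of "\<lambda>_. -1" "-1"]]
  by (simp add: qscale_minus_one)

lemma convergent_if_dist_le_null_add:
  fixes a :: "nat \<Rightarrow> 'a::complete_space"
  assumes "\<And>k l. dist (a k) (a l) \<le> B k + B l" "B \<longlonglongrightarrow> 0"
  shows "convergent a"
proof -
  have "Cauchy a"
  proof (rule metric_CauchyI)
    fix e :: real assume "0 < e"
    then have "\<forall>\<^sub>F n in sequentially. B n < e / 2"
      using order_tendstoD(2)[OF assms(2), of "e / 2"] by simp
    then obtain N where "\<And>n. n \<ge> N \<Longrightarrow> B n < e / 2"
      by (auto simp: eventually_sequentially)
    then have "dist (a m) (a n) < e" if "m \<ge> N" "n \<ge> N" for m n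
      using assms(1)[of m n] that by (smt (verit) field_sum_of_halves)
    then show "\<exists>M. \<forall>m\<ge>M. \<forall>n\<ge>M. dist (a m) (a n) < e" by blast
  qed
  then show ?thesis by (simp add: Cauchy_convergent_iff)
qed

locale seminorm_on_V =
  fixes \<mu> :: "V \<Rightarrow> real"
  assumes seminorm: "seminormV \<mu>"
begin

lemma nonneg [simp]: "0 \<le> \<mu> v"
  and triangle: "\<mu> (v + w) \<le> \<mu> v + \<mu> w"
  and scale: "\<mu> (qscale q v) = \<bar>of_rat q\<bar> * \<mu> v"
  using seminorm by (auto simp: seminormV_def)

lemma zero [simp]: "\<mu> 0 = 0"
  using scale[of 0 0] by (simp add: qscale_zero_left)

lemma uminus: "\<mu> (- v) = \<mu> v"
  using scale[of "-1" v] by (simp add: qscale_minus_one)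

lemma minus_commute: "\<mu> (v - w) = \<mu> (w - v)"
  using uminus[of "v - w"] by simp

lemma triangle_diff: "\<mu> (v - w) \<le> \<mu> v + \<mu> w"
  using triangle[of v "- w"] by (simp add: uminus)

lemma sum_le: "finite K \<Longrightarrow> \<mu> (\<Sum>i\<in>K. g i) \<le> (\<Sum>i\<in>K. \<mu> (g i))"
proof (induction K rule: finite_induct)
  case (insert i K)
  then show ?case using triangle[of "g i" "\<Sum>i\<in>K. g i"] by simp
qed simp

lemma le_sum_coords:
  assumes "finite K" "keys v \<subseteq> K"
  shows "\<mu> v \<le> (\<Sum>i\<in>K. \<bar>emb v i\<bar> * \<mu> (single i 1))"
proof -
  have "(\<Sum>i\<in>K. qscale (lookup v i) (single i 1)) = v"
    using assms by (intro poly_mapping_eqI)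
      (auto simp: lookup_sum lookup_single when_def if_distrib in_keys_iff cong: if_cong)
  then have "\<mu> v \<le> (\<Sum>i\<in>K. \<mu> (qscale (lookup v i) (single i 1)))"
    using sum_le[OF assms(1)] by metis
  then show ?thesis by (simp add: scale emb_def)
qed

text \<open>Both \<open>\<mu>\<close> and the functionals below \<open>\<mu>\<close> are contractions, so the limits defining
  \<open>mubar\<close> and \<open>Xn\<close> also serve to extend functionals from \<open>V\<close> to \<open>Xc \<mu>\<close>.\<close>

definition contraction :: "(V \<Rightarrow> real) \<Rightarrow> bool" where
  "contraction \<phi> \<longleftrightarrow> (\<forall>v w. \<bar>\<phi> v - \<phi> w\<bar> \<le> \<mu> (v - w))"

lemma contractionD: "contraction \<phi> \<Longrightarrow> \<bar>\<phi> v - \<phi> w\<bar> \<le> \<mu> (v - w)"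
  by (simp add: contraction_def)

lemma contraction_self: "contraction \<mu>"
  unfolding contraction_def
proof (intro allI)
  show "\<bar>\<mu> v - \<mu> w\<bar> \<le> \<mu> (v - w)" for v w
    using triangle[of "v - w" w] triangle[of "w - v" v] minus_commute[of v w] by simp
qed

lemma contraction_additive:
  assumes "Modules.additive f" "\<And>v. f v \<le> \<mu> v"
  shows "contraction f"
  unfolding contraction_def
proof (intro allI)
  show "\<bar>f v - f w\<bar> \<le> \<mu> (v - w)" for v w
    using assms(2)[of "v - w"] assms(2)[of "w - v"] minus_commute[of v w]
    by (simp add: additive.diff[OF assms(1)])
qed

lemma tendsto_null:
  assumes "c00_tendsto v (\<lambda>_. 0)"
  shows "(\<lambda>k. \<mu> (v k)) \<longlonglongrightarrow> 0"
proof -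
  obtain K where K: "finite K" "\<And>k. keys (v k) \<subseteq> K" and lim: "\<And>i. (\<lambda>k. emb (v k) i) \<longlonglongrightarrow> 0"
    using assms by (auto simp: c00_tendsto_def)
  have "(\<lambda>k. \<Sum>i\<in>K. \<bar>emb (v k) i\<bar> * \<mu> (single i 1)) \<longlonglongrightarrow> (\<Sum>i\<in>K. \<bar>0\<bar> * \<mu> (single i 1))"
    by (intro tendsto_intros lim)
  then have "(\<lambda>k. \<Sum>i\<in>K. \<bar>emb (v k) i\<bar> * \<mu> (single i 1)) \<longlonglongrightarrow> 0" by simp
  then show ?thesis
    by (rule Lim_null_comparison[rotated]) (use le_sum_coords[OF K] in simp)
qed

lemma convergent_rnd:
  assumes \<phi>: "contraction \<phi>" and x: "x \<in> c00"
  shows "convergent (\<lambda>k. \<phi> (rnd k x))"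
proof (rule convergent_if_dist_le_null_add)
  let ?K = "{i. x i \<noteq> 0}"
  define B where "B k = (\<Sum>i\<in>?K. \<bar>emb (rnd k x) i - x i\<bar> * \<mu> (single i 1))" for k
  have "B \<longlonglongrightarrow> (\<Sum>i\<in>?K. \<bar>x i - x i\<bar> * \<mu> (single i 1))"
    unfolding B_def using c00_tendsto_rnd[OF x]
    by (intro tendsto_intros) (auto simp: c00_tendsto_def)
  then show "B \<longlonglongrightarrow> 0" by simp
  fix k l
  have "keys (rnd k x - rnd l x) \<subseteq> ?K" "finite ?K"
    using x by (auto simp: c00_def in_keys_iff lookup_minus lookup_rnd rat_approx_def)
  then have "\<mu> (rnd k x - rnd l x) \<le> (\<Sum>i\<in>?K. \<bar>emb (rnd k x - rnd l x) i\<bar> * \<mu> (single i 1))"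
    by (intro le_sum_coords)
  also have "\<dots> \<le> B k + B l"
    unfolding B_def sum.distrib[symmetric] distrib_right[symmetric] emb_diff
    by (intro sum_mono mult_right_mono) auto
  finally show "dist (\<phi> (rnd k x)) (\<phi> (rnd l x)) \<le> B k + B l"
    unfolding dist_real_def using contractionD[OF \<phi>] by (rule order_trans[rotated])
qed

lemma tendsto_mubar_rnd:
  "contraction \<phi> \<Longrightarrow> x \<in> c00 \<Longrightarrow> (\<lambda>k. \<phi> (rnd k x)) \<longlonglongrightarrow> mubar \<phi> x"
  unfolding mubar_def by (rule convergent_LIMSEQ_iff[THEN iffD1]) (rule convergent_rnd)

lemma tendsto_mubar:
  assumes \<phi>: "contraction \<phi>" and x: "x \<in> c00" and v: "c00_tendsto v x"
  shows "(\<lambda>k. \<phi> (v k)) \<longlonglongrightarrow> mubar \<phi> x"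
proof -
  have "(\<lambda>k. \<mu> (v k - rnd k x)) \<longlonglongrightarrow> 0"
    using tendsto_null c00_tendsto_diff[OF v c00_tendsto_rnd[OF x]] by simp
  then have "(\<lambda>k. \<phi> (v k) - \<phi> (rnd k x)) \<longlonglongrightarrow> 0"
    by (rule Lim_null_comparison[rotated]) (simp add: contractionD[OF \<phi>])
  from tendsto_add[OF this tendsto_mubar_rnd[OF \<phi> x]] show ?thesis by simp
qed

lemma mubar_emb:
  assumes "contraction \<phi>"
  shows "mubar \<phi> (emb v) = \<phi> v"
  using tendsto_mubar[OF assms emb_c00 c00_tendsto_emb] tendsto_const by (rule LIMSEQ_unique)

lemma mubar_nonneg:
  assumes "x \<in> c00"
  shows "0 \<le> mubar \<mu> x"
  by (rule LIMSEQ_le_const[OF tendsto_mubar_rnd[OF contraction_self assms]]) simp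

lemma mubar_triangle:
  assumes "x \<in> c00" "y \<in> c00"
  shows "mubar \<mu> (\<lambda>i. x i + y i) \<le> mubar \<mu> x + mubar \<mu> y"
proof (rule LIMSEQ_le)
  show "(\<lambda>k. \<mu> (rnd k x + rnd k y)) \<longlonglongrightarrow> mubar \<mu> (\<lambda>i. x i + y i)"
    by (intro tendsto_mubar contraction_self c00_add c00_tendsto_add c00_tendsto_rnd assms)
  show "(\<lambda>k. \<mu> (rnd k x) + \<mu> (rnd k y)) \<longlonglongrightarrow> mubar \<mu> x + mubar \<mu> y"
    by (intro tendsto_add tendsto_mubar_rnd contraction_self assms)
qed (use triangle in blast)

lemma mubar_add:
  assumes "contraction \<phi>" "Modules.additive \<phi>" "x \<in> c00" "y \<in> c00"
  shows "mubar \<phi> (\<lambda>i. x i + y i) = mubar \<phi> x + mubar \<phi> y"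
proof (rule LIMSEQ_unique)
  show "(\<lambda>k. \<phi> (rnd k x + rnd k y)) \<longlonglongrightarrow> mubar \<phi> (\<lambda>i. x i + y i)"
    by (intro tendsto_mubar c00_add c00_tendsto_add c00_tendsto_rnd assms)
  show "(\<lambda>k. \<phi> (rnd k x + rnd k y)) \<longlonglongrightarrow> mubar \<phi> x + mubar \<phi> y"
    unfolding additive.add[OF assms(2)] by (intro tendsto_add tendsto_mubar_rnd assms)
qed

lemma mubar_homogeneous:
  assumes \<phi>: "contraction \<phi>" and hom: "\<And>q v. \<phi> (qscale q v) = h (of_rat q) * \<phi> v"
    and h: "continuous_on UNIV h" and x: "x \<in> c00"
  shows "mubar \<phi> (\<lambda>i. a * x i) = h a * mubar \<phi> x"
proof (rule LIMSEQ_unique)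
  let ?v = "\<lambda>k. qscale (rat_approx a k) (rnd k x)"
  show "(\<lambda>k. \<phi> (?v k)) \<longlonglongrightarrow> mubar \<phi> (\<lambda>i. a * x i)"
    by (intro tendsto_mubar c00_scale c00_tendsto_qscale c00_tendsto_rnd rat_approx_tendsto \<phi> x)
  have "(\<lambda>k. h (of_rat (rat_approx a k))) \<longlonglongrightarrow> h a"
    by (rule continuous_on_tendsto_compose[OF h rat_approx_tendsto]) auto
  then show "(\<lambda>k. \<phi> (?v k)) \<longlonglongrightarrow> h a * mubar \<phi> x"
    unfolding hom by (rule tendsto_mult[OF _ tendsto_mubar_rnd[OF \<phi> x]])
qed

lemma mubar_scale: "x \<in> c00 \<Longrightarrow> mubar \<mu> (\<lambda>i. a * x i) = \<bar>a\<bar> * mubar \<mu> x"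
  by (rule mubar_homogeneous[of \<mu> abs, OF contraction_self scale])
    (rule continuous_on_rabs[OF continuous_on_id])

lemma mubar_zero: "mubar \<mu> (\<lambda>_. 0) = 0"
  using mubar_emb[OF contraction_self, of 0] by (simp add: emb_zero)

lemma mubar_contraction:
  assumes "contraction \<phi>" "x \<in> c00" "y \<in> c00"
  shows "\<bar>mubar \<phi> x - mubar \<phi> y\<bar> \<le> mubar \<mu> (\<lambda>i. x i - y i)"
proof (rule LIMSEQ_le)
  show "(\<lambda>k. \<mu> (rnd k x - rnd k y)) \<longlonglongrightarrow> mubar \<mu> (\<lambda>i. x i - y i)"
    by (intro tendsto_mubar contraction_self c00_diff c00_tendsto_diff c00_tendsto_rnd assms)
  show "(\<lambda>k. \<bar>\<phi> (rnd k x) - \<phi> (rnd k y)\<bar>) \<longlonglongrightarrow> \<bar>mubar \<phi> x - mubar \<phi> y\<bar>"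
    by (intro tendsto_rabs tendsto_diff tendsto_mubar_rnd assms)
qed (simp add: contractionD[OF assms(1)])

lemma mubar_le_sum_coords:
  assumes "finite K" "{i. x i \<noteq> 0} \<subseteq> K"
  shows "mubar \<mu> x \<le> (\<Sum>i\<in>K. \<bar>x i\<bar> * \<mu> (single i 1))"
proof (rule LIMSEQ_le)
  have x: "x \<in> c00" using assms finite_subset by (auto simp: c00_def)
  show "(\<lambda>k. \<mu> (rnd k x)) \<longlonglongrightarrow> mubar \<mu> x"
    by (rule tendsto_mubar_rnd[OF contraction_self x])
  show "(\<lambda>k. \<Sum>i\<in>K. \<bar>emb (rnd k x) i\<bar> * \<mu> (single i 1)) \<longlonglongrightarrow> (\<Sum>i\<in>K. \<bar>x i\<bar> * \<mu> (single i 1))"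
    using c00_tendsto_rnd[OF x] by (intro tendsto_intros) (auto simp: c00_tendsto_def)
  show "\<exists>N. \<forall>k\<ge>N. \<mu> (rnd k x) \<le> (\<Sum>i\<in>K. \<bar>emb (rnd k x) i\<bar> * \<mu> (single i 1))"
    using le_sum_coords[OF assms(1) order_trans[OF keys_rnd[OF x] assms(2)]] by blast
qed

lemma mubar_dense:
  assumes x: "x \<in> c00" and "0 < e"
  obtains v where "mubar \<mu> (\<lambda>i. x i - emb v i) < e"
proof -
  let ?K = "{i. x i \<noteq> 0}"
  have "(\<lambda>k. \<Sum>i\<in>?K. \<bar>x i - emb (rnd k x) i\<bar> * \<mu> (single i 1))
      \<longlonglongrightarrow> (\<Sum>i\<in>?K. \<bar>x i - x i\<bar> * \<mu> (single i 1))"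
    using c00_tendsto_rnd[OF x] by (intro tendsto_intros) (auto simp: c00_tendsto_def)
  then have "\<forall>\<^sub>F k in sequentially. (\<Sum>i\<in>?K. \<bar>x i - emb (rnd k x) i\<bar> * \<mu> (single i 1)) < e"
    by (rule order_tendstoD) (simp add: \<open>0 < e\<close>)
  then obtain k where k: "(\<Sum>i\<in>?K. \<bar>x i - emb (rnd k x) i\<bar> * \<mu> (single i 1)) < e"
    by (auto simp: eventually_sequentially)
  have "finite ?K" "{i. x i - emb (rnd k x) i \<noteq> 0} \<subseteq> ?K"
    using x by (auto simp: c00_def emb_def lookup_rnd rat_approx_def)
  from order_le_less_trans[OF mubar_le_sum_coords[OF this] k] show ?thesis by (rule that)
qed

lemma Xc_c00: "s \<in> Xc \<mu> \<Longrightarrow> s k \<in> c00"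
  by (simp add: Xc_def)

lemma Xc_Cauchy:
  assumes "s \<in> Xc \<mu>" "0 < e"
  obtains N where "\<And>m n. m \<ge> N \<Longrightarrow> n \<ge> N \<Longrightarrow> mubar \<mu> (\<lambda>i. s m i - s n i) < e"
  using assms unfolding Xc_def by blast

lemma XcI:
  assumes "\<And>k. s k \<in> c00"
    and "\<And>e. 0 < e \<Longrightarrow> \<exists>N. \<forall>m\<ge>N. \<forall>n\<ge>N. mubar \<mu> (\<lambda>i. s m i - s n i) < e"
  shows "s \<in> Xc \<mu>"
  using assms by (simp add: Xc_def)

lemma Xn_tendsto:
  assumes \<phi>: "contraction \<phi>" and s: "s \<in> Xc \<mu>"
  shows "(\<lambda>k. mubar \<phi> (s k)) \<longlonglongrightarrow> Xn \<phi> s"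
proof -
  have "Cauchy (\<lambda>k. mubar \<phi> (s k))"
  proof (rule metric_CauchyI)
    fix e :: real assume "0 < e"
    then obtain N where "\<And>m n. m \<ge> N \<Longrightarrow> n \<ge> N \<Longrightarrow> mubar \<mu> (\<lambda>i. s m i - s n i) < e"
      using Xc_Cauchy[OF s] by blast
    then show "\<exists>M. \<forall>m\<ge>M. \<forall>n\<ge>M. dist (mubar \<phi> (s m)) (mubar \<phi> (s n)) < e"
      using mubar_contraction[OF \<phi> Xc_c00[OF s] Xc_c00[OF s]] unfolding dist_real_def
      by (meson order_le_less_trans)
  qed
  then show ?thesis
    by (simp add: Xn_def Cauchy_convergent_iff convergent_LIMSEQ_iff)
qed

lemma Xc_const: "x \<in> c00 \<Longrightarrow> (\<lambda>_. x) \<in> Xc \<mu>"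
  by (simp add: Xc_def mubar_zero)

lemma Xn_const: "Xn \<phi> (\<lambda>_. x) = mubar \<phi> x"
  by (simp add: Xn_def)

lemma Xc_add:
  assumes s: "s \<in> Xc \<mu>" and t: "t \<in> Xc \<mu>"
  shows "(\<lambda>k j. s k j + t k j) \<in> Xc \<mu>"
proof (rule XcI)
  show "(\<lambda>j. s k j + t k j) \<in> c00" for k
    by (intro c00_add Xc_c00 s t)
  fix e :: real assume "0 < e"
  then have "0 < e / 2" by simp
  then obtain N M where N: "\<And>m n. m \<ge> N \<Longrightarrow> n \<ge> N \<Longrightarrow> mubar \<mu> (\<lambda>i. s m i - s n i) < e / 2"
    and M: "\<And>m n. m \<ge> M \<Longrightarrow> n \<ge> M \<Longrightarrow> mubar \<mu> (\<lambda>i. t m i - t n i) < e / 2"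
    using Xc_Cauchy[OF s, of "e / 2"] Xc_Cauchy[OF t, of "e / 2"] by metis
  have "mubar \<mu> (\<lambda>i. s m i + t m i - (s n i + t n i)) < e" if "m \<ge> max N M" "n \<ge> max N M" for m n
  proof -
    have "mubar \<mu> (\<lambda>i. (s m i - s n i) + (t m i - t n i))
        \<le> mubar \<mu> (\<lambda>i. s m i - s n i) + mubar \<mu> (\<lambda>i. t m i - t n i)"
      by (intro mubar_triangle c00_diff Xc_c00 s t)
    also have "\<dots> < e" using N[of m n] M[of m n] that by simp
    finally show ?thesis by (simp add: algebra_simps)
  qed
  then show "\<exists>N. \<forall>m\<ge>N. \<forall>n\<ge>N. mubar \<mu> (\<lambda>i. s m i + t m i - (s n i + t n i)) < e"
    by blast
qed

lemma Xc_scale: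
  assumes s: "s \<in> Xc \<mu>"
  shows "(\<lambda>k j. a * s k j) \<in> Xc \<mu>"
proof (rule XcI)
  show "(\<lambda>j. a * s k j) \<in> c00" for k
    by (intro c00_scale Xc_c00 s)
  fix e :: real assume e: "0 < e"
  then have "0 < e / (\<bar>a\<bar> + 1)" by simp
  then obtain N where N: "\<And>m n. m \<ge> N \<Longrightarrow> n \<ge> N \<Longrightarrow> mubar \<mu> (\<lambda>i. s m i - s n i) < e / (\<bar>a\<bar> + 1)"
    using Xc_Cauchy[OF s] by blast
  have "mubar \<mu> (\<lambda>i. a * s m i - a * s n i) < e" if "m \<ge> N" "n \<ge> N" for m n
  proof -
    have "mubar \<mu> (\<lambda>i. a * s m i - a * s n i) = \<bar>a\<bar> * mubar \<mu> (\<lambda>i. s m i - s n i)"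
      using mubar_scale[OF c00_diff[OF Xc_c00[OF s] Xc_c00[OF s]], of a m n]
      by (simp add: right_diff_distrib)
    also have "\<dots> \<le> \<bar>a\<bar> * (e / (\<bar>a\<bar> + 1))"
      using N[OF that] by (intro mult_left_mono) auto
    also have "\<dots> < e" using e by (simp add: divide_simps mult_less_cancel_right)
    finally show ?thesis .
  qed
  then show "\<exists>N. \<forall>m\<ge>N. \<forall>n\<ge>N. mubar \<mu> (\<lambda>i. a * s m i - a * s n i) < e" by blast
qed

lemma Xc_diff: "s \<in> Xc \<mu> \<Longrightarrow> t \<in> Xc \<mu> \<Longrightarrow> (\<lambda>k j. s k j - t k j) \<in> Xc \<mu>"
  using Xc_add[OF _ Xc_scale[of t "-1"], of s] by simp

lemma Xn_nonneg:
  assumes "s \<in> Xc \<mu>"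
  shows "0 \<le> Xn \<mu> s"
  by (rule LIMSEQ_le_const[OF Xn_tendsto[OF contraction_self assms]])
    (use mubar_nonneg[OF Xc_c00[OF assms]] in simp)

lemma Xn_triangle:
  assumes s: "s \<in> Xc \<mu>" and t: "t \<in> Xc \<mu>"
  shows "Xn \<mu> (\<lambda>k j. s k j + t k j) \<le> Xn \<mu> s + Xn \<mu> t"
proof (rule LIMSEQ_le)
  show "(\<lambda>k. mubar \<mu> (\<lambda>j. s k j + t k j)) \<longlonglongrightarrow> Xn \<mu> (\<lambda>k j. s k j + t k j)"
    by (intro Xn_tendsto contraction_self Xc_add s t)
  show "(\<lambda>k. mubar \<mu> (s k) + mubar \<mu> (t k)) \<longlonglongrightarrow> Xn \<mu> s + Xn \<mu> t"
    by (intro tendsto_add Xn_tendsto contraction_self s t)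
qed (use mubar_triangle[OF Xc_c00[OF s] Xc_c00[OF t]] in blast)

lemma Xn_add:
  assumes \<phi>: "contraction \<phi>" "Modules.additive \<phi>" and s: "s \<in> Xc \<mu>" and t: "t \<in> Xc \<mu>"
  shows "Xn \<phi> (\<lambda>k j. s k j + t k j) = Xn \<phi> s + Xn \<phi> t"
proof (rule LIMSEQ_unique)
  show "(\<lambda>k. mubar \<phi> (\<lambda>j. s k j + t k j)) \<longlonglongrightarrow> Xn \<phi> (\<lambda>k j. s k j + t k j)"
    by (intro Xn_tendsto Xc_add \<phi>(1) s t)
  show "(\<lambda>k. mubar \<phi> (\<lambda>j. s k j + t k j)) \<longlonglongrightarrow> Xn \<phi> s + Xn \<phi> t"
    unfolding mubar_add[OF \<phi> Xc_c00[OF s] Xc_c00[OF t]] by (intro tendsto_add Xn_tendsto \<phi>(1) s t)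
qed

lemma Xn_homogeneous:
  assumes \<phi>: "contraction \<phi>" "\<And>q v. \<phi> (qscale q v) = h (of_rat q) * \<phi> v" "continuous_on UNIV h"
    and s: "s \<in> Xc \<mu>"
  shows "Xn \<phi> (\<lambda>k j. a * s k j) = h a * Xn \<phi> s"
proof (rule LIMSEQ_unique)
  show "(\<lambda>k. mubar \<phi> (\<lambda>j. a * s k j)) \<longlonglongrightarrow> Xn \<phi> (\<lambda>k j. a * s k j)"
    by (intro Xn_tendsto Xc_scale \<phi>(1) s)
  show "(\<lambda>k. mubar \<phi> (\<lambda>j. a * s k j)) \<longlonglongrightarrow> h a * Xn \<phi> s"
    unfolding mubar_homogeneous[OF \<phi> Xc_c00[OF s]] by (intro tendsto_mult_left Xn_tendsto \<phi>(1) s)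
qed

lemma Xn_scale: "s \<in> Xc \<mu> \<Longrightarrow> Xn \<mu> (\<lambda>k j. a * s k j) = \<bar>a\<bar> * Xn \<mu> s"
  by (rule Xn_homogeneous[of \<mu> abs, OF contraction_self scale])
    (rule continuous_on_rabs[OF continuous_on_id])

lemma Xn_triangle_diff:
  assumes s: "s \<in> Xc \<mu>" and t: "t \<in> Xc \<mu>"
  shows "Xn \<mu> (\<lambda>k j. s k j - t k j) \<le> Xn \<mu> s + Xn \<mu> t"
  using Xn_triangle[OF s Xc_scale[OF t, of "-1"]] Xn_scale[OF t, of "-1"] by simp

lemma Xn_contraction:
  assumes \<phi>: "contraction \<phi>" and s: "s \<in> Xc \<mu>" and t: "t \<in> Xc \<mu>"
  shows "\<bar>Xn \<phi> s - Xn \<phi> t\<bar> \<le> Xn \<mu> (\<lambda>k j. s k j - t k j)"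
proof (rule LIMSEQ_le)
  show "(\<lambda>k. \<bar>mubar \<phi> (s k) - mubar \<phi> (t k)\<bar>) \<longlonglongrightarrow> \<bar>Xn \<phi> s - Xn \<phi> t\<bar>"
    by (intro tendsto_rabs tendsto_diff Xn_tendsto \<phi> s t)
  show "(\<lambda>k. mubar \<mu> (\<lambda>j. s k j - t k j)) \<longlonglongrightarrow> Xn \<mu> (\<lambda>k j. s k j - t k j)"
    by (intro Xn_tendsto contraction_self Xc_diff s t)
qed (use mubar_contraction[OF \<phi> Xc_c00[OF s] Xc_c00[OF t]] in blast)

end

definition to_Xc :: "V \<Rightarrow> nat \<Rightarrow> nat \<Rightarrow> real" where
  "to_Xc v = (\<lambda>_. emb v)"

lemma to_Xc_zero: "to_Xc 0 = (\<lambda>k j. 0)"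
  and to_Xc_add: "to_Xc (v + w) = (\<lambda>k j. to_Xc v k j + to_Xc w k j)"
  and to_Xc_diff: "to_Xc (v - w) = (\<lambda>k j. to_Xc v k j - to_Xc w k j)"
  by (simp_all add: to_Xc_def emb_zero emb_add emb_diff)

context seminorm_on_V
begin

lemma to_Xc_in_Xc [simp]: "to_Xc v \<in> Xc \<mu>"
  by (simp add: to_Xc_def Xc_const)

lemma Xn_to_Xc: "contraction \<phi> \<Longrightarrow> Xn \<phi> (to_Xc v) = \<phi> v"
  by (simp add: to_Xc_def Xn_const mubar_emb)

lemma Xn_to_Xc_self [simp]: "Xn \<mu> (to_Xc v) = \<mu> v"
  by (rule Xn_to_Xc[OF contraction_self])

lemma Xn_dense:
  assumes s: "s \<in> Xc \<mu>" and "0 < e"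
  obtains v where "Xn \<mu> (\<lambda>k j. s k j - to_Xc v k j) < e"
proof -
  have "0 < e / 2" using \<open>0 < e\<close> by simp
  then obtain N where N: "\<And>m n. m \<ge> N \<Longrightarrow> n \<ge> N \<Longrightarrow> mubar \<mu> (\<lambda>i. s m i - s n i) < e / 2"
    using Xc_Cauchy[OF s] by blast
  have s_N: "(\<lambda>_. s N) \<in> Xc \<mu>" by (intro Xc_const Xc_c00 s)
  have tail: "Xn \<mu> (\<lambda>k j. s k j - s N j) \<le> e / 2"
    by (rule LIMSEQ_le_const2[OF Xn_tendsto[OF contraction_self Xc_diff[OF s s_N]]])
      (use N less_imp_le in blast)
  obtain v where v: "mubar \<mu> (\<lambda>i. s N i - emb v i) < e / 2"
    using mubar_dense[OF Xc_c00[OF s] \<open>0 < e / 2\<close>] by blast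
  have "Xn \<mu> (\<lambda>k j. (s k j - s N j) + (s N j - to_Xc v k j))
      \<le> Xn \<mu> (\<lambda>k j. s k j - s N j) + Xn \<mu> (\<lambda>k j. s N j - to_Xc v k j)"
    by (intro Xn_triangle Xc_diff s s_N to_Xc_in_Xc)
  also have "\<dots> < e" using tail v by (simp add: to_Xc_def Xn_const)
  finally show ?thesis using that[of v] by simp
qed

definition approximates :: "(nat \<Rightarrow> V) \<Rightarrow> (nat \<Rightarrow> nat \<Rightarrow> real) \<Rightarrow> bool" where
  "approximates v s \<longleftrightarrow> (\<lambda>n. Xn \<mu> (\<lambda>k j. s k j - to_Xc (v n) k j)) \<longlonglongrightarrow> 0"

lemma approximates_exists:
  assumes "s \<in> Xc \<mu>"
  obtains v where "approximates v s"
proof -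
  have "\<exists>v. Xn \<mu> (\<lambda>k j. s k j - to_Xc v k j) < 1 / real (Suc n)" for n
    using Xn_dense[OF assms, of "1 / real (Suc n)"] by auto
  then obtain v where v: "\<And>n. Xn \<mu> (\<lambda>k j. s k j - to_Xc (v n) k j) < 1 / real (Suc n)"
    by metis
  have "0 \<le> Xn \<mu> (\<lambda>k j. s k j - to_Xc (v n) k j)" for n
    by (intro Xn_nonneg Xc_diff assms to_Xc_in_Xc)
  then have "norm (Xn \<mu> (\<lambda>k j. s k j - to_Xc (v n) k j)) \<le> 1 / real (Suc n)" for n
    using v[of n] by (simp del: of_nat_Suc)
  then have "approximates v s"
    unfolding approximates_def
    by (intro Lim_null_comparison[OF always_eventually LIMSEQ_Suc[OF lim_1_over_n]]) blast
  then show ?thesis by (rule that)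
qed

lemma approximates_diff:
  assumes s: "s \<in> Xc \<mu>" "approximates v s" and t: "t \<in> Xc \<mu>" "approximates w t"
  shows "approximates (\<lambda>n. v n - w n) (\<lambda>k j. s k j - t k j)"
proof -
  let ?error = "\<lambda>s v k j. s k j - to_Xc v k j"
  have error_Xc: "?error s (v n) \<in> Xc \<mu>" "?error t (w n) \<in> Xc \<mu>" for n
    by (intro Xc_diff s(1) t(1) to_Xc_in_Xc)+
  have error_diff: "(\<lambda>k j. s k j - t k j - to_Xc (v n - w n) k j)
      = (\<lambda>k j. ?error s (v n) k j - ?error t (w n) k j)" for n
    by (simp add: to_Xc_diff algebra_simps)
  have bound: "norm (Xn \<mu> (\<lambda>k j. ?error s (v n) k j - ?error t (w n) k j))
      \<le> Xn \<mu> (?error s (v n)) + Xn \<mu> (?error t (w n))" for n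
    using Xn_nonneg[OF Xc_diff[OF error_Xc]] Xn_triangle_diff[OF error_Xc] by simp
  have "(\<lambda>n. Xn \<mu> (?error s (v n)) + Xn \<mu> (?error t (w n))) \<longlonglongrightarrow> 0"
    using tendsto_add[OF s(2)[unfolded approximates_def] t(2)[unfolded approximates_def]] by simp
  then show ?thesis
    unfolding approximates_def error_diff
    by (rule Lim_null_comparison[OF always_eventually, rotated]) (use bound in blast)
qed

lemma tendsto_approximates:
  assumes "\<And>t. t \<in> Xc \<mu> \<Longrightarrow> \<bar>\<Phi> s - \<Phi> t\<bar> \<le> Xn \<mu> (\<lambda>k j. s k j - t k j)" "approximates v s"
  shows "(\<lambda>n. \<Phi> (to_Xc (v n))) \<longlonglongrightarrow> \<Phi> s"
proof -
  have "(\<lambda>n. \<Phi> s - \<Phi> (to_Xc (v n))) \<longlonglongrightarrow> 0"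
    using assms(2) unfolding approximates_def
    by (rule Lim_null_comparison[rotated]) (simp add: assms(1))
  from tendsto_diff[OF tendsto_const[of "\<Phi> s"] this] show ?thesis by simp
qed

lemma tendsto_Xn:
  assumes "contraction \<phi>" "s \<in> Xc \<mu>" "approximates v s"
  shows "(\<lambda>n. \<phi> (v n)) \<longlonglongrightarrow> Xn \<phi> s"
  using tendsto_approximates[of "Xn \<phi>", OF Xn_contraction[OF assms(1,2)] assms(3)]
  by (simp add: Xn_to_Xc[OF assms(1)])

end

subsection \<open>The slice condition in terms of functionals on V\<close>

lemma additive_of_rat:
  fixes \<phi> :: "rat \<Rightarrow> real"
  assumes "Modules.additive \<phi>"
  shows "\<phi> q = of_rat q * \<phi> 1"
proof -
  interpret Modules.additive \<phi> by (rule assms)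
  have of_nat: "\<phi> (of_nat n * x) = of_nat n * \<phi> x" for n x
    by (induction n) (simp_all add: zero add distrib_right)
  have of_int: "\<phi> (of_int m * x) = of_int m * \<phi> x" for m x
    by (cases m rule: int_cases2) (simp_all add: of_nat minus)
  obtain a b where q: "q = of_int a / of_int b" "b > 0"
    by (metis Fract_of_int_quotient Rat_cases)
  then have "of_int b * q = of_int a * 1" by simp
  then have "of_int b * \<phi> q = of_int a * \<phi> 1" using of_int by metis
  then show ?thesis using q(2) by (simp add: q(1) of_rat_divide field_simps)
qed

lemma additive_qscale:
  fixes f :: "V \<Rightarrow> real"
  assumes "Modules.additive f"
  shows "f (qscale q v) = of_rat q * f v"
proof -
  have "Modules.additive (\<lambda>q. f (qscale q v))"
    by unfold_locales (simp add: qscale_add_left additive.add[OF assms])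
  from additive_of_rat[OF this, of q] show ?thesis by (simp add: qscale_one)
qed

definition Xc_linear :: "(V \<Rightarrow> real) \<Rightarrow> ((nat \<Rightarrow> nat \<Rightarrow> real) \<Rightarrow> real) \<Rightarrow> bool" where
  "Xc_linear \<mu> F \<longleftrightarrow> (\<forall>s\<in>Xc \<mu>. \<forall>t\<in>Xc \<mu>. F (\<lambda>k j. s k j + t k j) = F s + F t)
    \<and> (\<forall>a. \<forall>s\<in>Xc \<mu>. F (\<lambda>k j. a * s k j) = a * F s)"

lemma Xc_linear_add:
    "Xc_linear \<mu> F \<Longrightarrow> s \<in> Xc \<mu> \<Longrightarrow> t \<in> Xc \<mu> \<Longrightarrow> F (\<lambda>k j. s k j + t k j) = F s + F t"
  and Xc_linear_scale: "Xc_linear \<mu> F \<Longrightarrow> s \<in> Xc \<mu> \<Longrightarrow> F (\<lambda>k j. a * s k j) = a * F s"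
  by (simp_all add: Xc_linear_def)

lemma dual_sphere_linear: "dual_sphere \<mu> F \<Longrightarrow> Xc_linear \<mu> F"
  by (simp add: dual_sphere_def Xc_linear_def)

definition Xc_ball :: "(V \<Rightarrow> real) \<Rightarrow> (nat \<Rightarrow> nat \<Rightarrow> real) set" where
  "Xc_ball \<mu> = {s \<in> Xc \<mu>. Xn \<mu> s \<le> 1}"

definition norming :: "(V \<Rightarrow> real) \<Rightarrow> (V \<Rightarrow> real) \<Rightarrow> bool" where
  "norming \<mu> f \<longleftrightarrow> Modules.additive f \<and> (\<forall>v. f v \<le> \<mu> v) \<and>
     (\<forall>s. 0 \<le> s \<and> s < 1 \<longrightarrow> (\<exists>v. s * \<mu> v < f v))"

text \<open>Points \<open>a / r\<close>, \<open>b / r\<close> of the unit ball at distance greater than \<open>c\<close> are recorded by their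
  midpoint \<open>(a + b) / (2 * r)\<close>, as numerator and denominator because \<open>r\<close> need not be rational. A
  slice contains both points as soon as the slice of half the width contains the midpoint.\<close>

definition far_pairs :: "(V \<Rightarrow> real) \<Rightarrow> real \<Rightarrow> (real \<times> V) set" where
  "far_pairs \<mu> c = {(2 * r, a + b) | r a b. \<mu> a < r \<and> \<mu> b < r \<and> c * r < \<mu> (a - b)}"

definition norming_set :: "(V \<Rightarrow> real) \<Rightarrow> (real \<times> V) set \<Rightarrow> bool" where
  "norming_set \<mu> T \<longleftrightarrow> (\<forall>f s. norming \<mu> f \<and> s < 1 \<longrightarrow> (\<exists>(r, u)\<in>T. s * r < f u))"

lemma norming_setE:
  assumes "norming_set \<mu> T" "norming \<mu> f" "s < 1"
  obtains r u where "(r, u) \<in> T" "s * r < f u"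
  using assms unfolding norming_set_def by blast

lemma far_pairs_slice:
  assumes f: "Modules.additive f" "\<And>v. f v \<le> \<mu> v"
    and "(R, u) \<in> far_pairs \<mu> c" "(1 + s) / 2 * R < f u"
  obtains r a b where "\<mu> a < r" "\<mu> b < r" "s * r < f a" "s * r < f b" "c * r < \<mu> (a - b)"
proof -
  obtain r a b where rab: "R = 2 * r" "u = a + b" "\<mu> a < r" "\<mu> b < r" "c * r < \<mu> (a - b)"
    using assms(3) by (auto simp: far_pairs_def)
  then have "(1 + s) * r < f a + f b"
    using assms(4) by (simp add: additive.add[OF f(1)])
  then have "s * r < f a" "s * r < f b"
    using f(2)[of a] f(2)[of b] rab(3,4) by (simp_all add: algebra_simps)
  with rab(3-5) show ?thesis using that by blast
qed

context seminorm_on_V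
begin

lemma dual_sphere_bdd_above_ball:
  assumes "dual_sphere \<mu> F"
  shows "bdd_above ((\<lambda>s. \<bar>F s\<bar>) ` Xc_ball \<mu>)"
proof -
  obtain C where C: "\<And>s. s \<in> Xc \<mu> \<Longrightarrow> \<bar>F s\<bar> \<le> C * Xn \<mu> s"
    using assms unfolding dual_sphere_def by blast
  have "\<bar>F s\<bar> \<le> \<bar>C\<bar>" if "s \<in> Xc_ball \<mu>" for s
  proof -
    have s: "s \<in> Xc \<mu>" "Xn \<mu> s \<le> 1" using that by (auto simp: Xc_ball_def)
    have "\<bar>F s\<bar> \<le> C * Xn \<mu> s" by (rule C[OF s(1)])
    also have "\<dots> \<le> \<bar>C\<bar> * Xn \<mu> s" using Xn_nonneg[OF s(1)] by (intro mult_right_mono) auto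
    also have "\<dots> \<le> \<bar>C\<bar>" using s(2) by (simp add: mult_left_le)
    finally show ?thesis .
  qed
  then show ?thesis by (rule bdd_aboveI2)
qed

lemma dual_sphere_le:
  assumes F: "dual_sphere \<mu> F" and s: "s \<in> Xc \<mu>"
  shows "\<bar>F s\<bar> \<le> Xn \<mu> s"
proof (cases "Xn \<mu> s = 0")
  case True
  then show ?thesis using F s unfolding dual_sphere_def by force
next
  case False
  then have pos: "0 < Xn \<mu> s" using Xn_nonneg[OF s] by simp
  let ?t = "\<lambda>k j. (1 / Xn \<mu> s) * s k j"
  have "Xn \<mu> ?t = 1"
    unfolding Xn_scale[OF s] using pos by simp
  then have "?t \<in> Xc_ball \<mu>"
    using Xc_scale[OF s] by (simp only: Xc_ball_def mem_Collect_eq order_refl)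
  then have "\<bar>F ?t\<bar> \<le> (SUP s\<in>Xc_ball \<mu>. \<bar>F s\<bar>)"
    by (rule cSUP_upper[OF _ dual_sphere_bdd_above_ball[OF F]])
  also have "\<dots> = 1" using F by (simp add: dual_sphere_def Xc_ball_def)
  finally have "\<bar>F s\<bar> / Xn \<mu> s \<le> 1"
    using pos unfolding Xc_linear_scale[OF dual_sphere_linear[OF F] s] by (simp add: abs_mult)
  then show ?thesis using pos by (simp add: pos_divide_le_eq)
qed

lemma dual_sphere_almost_attained:
  assumes F: "dual_sphere \<mu> F" and "c < 1"
  obtains s where "s \<in> Xc_ball \<mu>" "c < F s"
proof -
  have "(\<lambda>k j. 0) \<in> Xc_ball \<mu>"
    using to_Xc_in_Xc[of 0] Xn_to_Xc_self[of 0] by (simp add: Xc_ball_def to_Xc_zero)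
  moreover have "c < (SUP s\<in>Xc_ball \<mu>. \<bar>F s\<bar>)"
    using F \<open>c < 1\<close> by (simp add: dual_sphere_def Xc_ball_def)
  ultimately obtain s where s: "s \<in> Xc_ball \<mu>" "c < \<bar>F s\<bar>"
    using less_cSUP_iff[OF _ dual_sphere_bdd_above_ball[OF F]] by blast
  then have Xc: "s \<in> Xc \<mu>" by (simp add: Xc_ball_def)
  have "(\<lambda>k j. - 1 * s k j) \<in> Xc_ball \<mu>"
    using s(1) Xc_scale[OF Xc, of "- 1"] Xn_scale[OF Xc, of "- 1"] by (simp add: Xc_ball_def)
  moreover have "F (\<lambda>k j. - 1 * s k j) = - F s"
    using Xc_linear_scale[OF dual_sphere_linear[OF F] Xc, of "- 1"] by simp
  ultimately show ?thesis using that s by (cases "0 \<le> F s") force+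
qed

lemma dual_sphereI:
  assumes linear: "Xc_linear \<mu> F" and le: "\<And>s. s \<in> Xc \<mu> \<Longrightarrow> \<bar>F s\<bar> \<le> Xn \<mu> s"
    and attained: "\<And>c. 0 \<le> c \<Longrightarrow> c < 1 \<Longrightarrow> \<exists>s\<in>Xc_ball \<mu>. c < F s"
  shows "dual_sphere \<mu> F"
proof -
  have ball_le: "\<bar>F s\<bar> \<le> 1" if "s \<in> Xc_ball \<mu>" for s
    using le[of s] that by (auto simp: Xc_ball_def)
  then have bdd: "bdd_above ((\<lambda>s. \<bar>F s\<bar>) ` Xc_ball \<mu>)" by (rule bdd_aboveI2)
  have "(SUP s\<in>Xc_ball \<mu>. \<bar>F s\<bar>) = 1"
  proof (rule antisym)
    show "(SUP s\<in>Xc_ball \<mu>. \<bar>F s\<bar>) \<le> 1"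
      using attained[of 0] ball_le by (intro cSUP_least) auto
    show "1 \<le> (SUP s\<in>Xc_ball \<mu>. \<bar>F s\<bar>)"
    proof (rule dense_le_bounded[of 0])
      fix c :: real assume "0 < c" "c < 1"
      then obtain s where s: "s \<in> Xc_ball \<mu>" "c < F s" using attained[of c] by auto
      then show "c \<le> (SUP s\<in>Xc_ball \<mu>. \<bar>F s\<bar>)" using cSUP_upper[OF s(1) bdd] by linarith
    qed simp
  qed
  moreover have "\<forall>s\<in>Xc \<mu>. \<bar>F s\<bar> \<le> 1 * Xn \<mu> s" using le by simp
  ultimately show ?thesis
    using linear unfolding dual_sphere_def Xc_linear_def Xc_ball_def by blast
qed

lemma norming_restrict_dual_sphere:
  assumes F: "dual_sphere \<mu> F"
  shows "norming \<mu> (\<lambda>v. F (to_Xc v))"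
  unfolding norming_def
proof (intro conjI allI impI)
  note linear = dual_sphere_linear[OF F]
  show "Modules.additive (\<lambda>v. F (to_Xc v))"
    by unfold_locales (simp add: to_Xc_add Xc_linear_add[OF linear])
  show "F (to_Xc v) \<le> \<mu> v" for v
    using dual_sphere_le[OF F, of "to_Xc v"] by simp
  fix s :: real assume s: "0 \<le> s \<and> s < 1"
  obtain x where x: "x \<in> Xc \<mu>" "Xn \<mu> x \<le> 1" "s < F x"
    using dual_sphere_almost_attained[OF F, of s] s by (auto simp: Xc_ball_def)
  have F_diff: "F x - F y = F (\<lambda>k j. x k j - y k j)" if "y \<in> Xc \<mu>" for y
    using Xc_linear_add[OF linear x(1) Xc_scale[OF that, of "- 1"]]
      Xc_linear_scale[OF linear that, of "- 1"] by simp
  obtain v where v: "approximates v x" using approximates_exists[OF x(1)] .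
  have "(\<lambda>n. F (to_Xc (v n))) \<longlonglongrightarrow> F x"
    using v by (rule tendsto_approximates[rotated])
      (simp add: F_diff dual_sphere_le[OF F] Xc_diff x(1))
  moreover have "(\<lambda>n. s * \<mu> (v n)) \<longlonglongrightarrow> s * Xn \<mu> x"
    by (intro tendsto_mult_left tendsto_Xn contraction_self x(1) v)
  ultimately have "(\<lambda>n. F (to_Xc (v n)) - s * \<mu> (v n)) \<longlonglongrightarrow> F x - s * Xn \<mu> x"
    by (rule tendsto_diff)
  moreover have "0 < F x - s * Xn \<mu> x"
    using s x(2,3) mult_left_le[of "Xn \<mu> x" s] by simp
  ultimately have "\<forall>\<^sub>F n in sequentially. 0 < F (to_Xc (v n)) - s * \<mu> (v n)"
    by (rule order_tendstoD)
  then show "\<exists>v. s * \<mu> v < F (to_Xc v)"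
    by (auto simp: eventually_sequentially)
qed

lemma dual_sphere_extend_norming:
  assumes f: "norming \<mu> f"
  shows "dual_sphere \<mu> (Xn f)"
proof (rule dual_sphereI)
  have additive: "Modules.additive f" and le: "\<And>v. f v \<le> \<mu> v"
    using f by (simp_all add: norming_def)
  have contr: "contraction f" using additive le by (rule contraction_additive)
  show linear: "Xc_linear \<mu> (Xn f)"
    unfolding Xc_linear_def
  proof (intro conjI allI ballI)
    show "Xn f (\<lambda>k j. s k j + t k j) = Xn f s + Xn f t" if "s \<in> Xc \<mu>" "t \<in> Xc \<mu>" for s t
      using contr additive that by (rule Xn_add)
    show "Xn f (\<lambda>k j. a * s k j) = a * Xn f s" if "s \<in> Xc \<mu>" for a s
      by (rule Xn_homogeneous[of f "\<lambda>x. x", OF contr additive_qscale[OF additive]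
            continuous_on_id that])
  qed
  show "\<bar>Xn f s\<bar> \<le> Xn \<mu> s" if "s \<in> Xc \<mu>" for s
    using Xn_contraction[OF contr that to_Xc_in_Xc, of 0] Xn_to_Xc[OF contr, of 0]
    by (simp add: additive.zero[OF additive] to_Xc_zero)
  fix c :: real assume c: "0 \<le> c" "c < 1"
  then obtain v where v: "c * \<mu> v < f v" using f by (auto simp: norming_def)
  have "0 \<le> c * \<mu> v" using c by simp
  then have pos: "0 < \<mu> v" using v le[of v] by linarith
  let ?s = "\<lambda>k j. (1 / \<mu> v) * to_Xc v k j"
  have "?s \<in> Xc_ball \<mu>"
    using pos Xc_scale[of "to_Xc v" "1 / \<mu> v"] Xn_scale[of "to_Xc v" "1 / \<mu> v"]
    by (simp add: Xc_ball_def)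
  moreover have "Xn f ?s = f v / \<mu> v"
    using Xc_linear_scale[OF linear, of "to_Xc v" "1 / \<mu> v"] by (simp add: Xn_to_Xc[OF contr])
  then have "c < Xn f ?s" using v pos by (simp add: pos_less_divide_eq)
  ultimately show "\<exists>s\<in>Xc_ball \<mu>. c < Xn f s" by blast
qed

lemma slice_diameter_ge_iff:
  assumes "slice \<mu> F \<alpha> \<noteq> {}"
  shows "\<delta> \<le> (SUP p\<in>slice \<mu> F \<alpha> \<times> slice \<mu> F \<alpha>. Xn \<mu> (\<lambda>k j. fst p k j - snd p k j)) \<longleftrightarrow>
    (\<forall>c<\<delta>. \<exists>s\<in>slice \<mu> F \<alpha>. \<exists>t\<in>slice \<mu> F \<alpha>. c < Xn \<mu> (\<lambda>k j. s k j - t k j))"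
proof -
  let ?S = "slice \<mu> F \<alpha> \<times> slice \<mu> F \<alpha>"
  have "Xn \<mu> (\<lambda>k j. fst p k j - snd p k j) \<le> 2" if "p \<in> ?S" for p
  proof -
    have "fst p \<in> Xc \<mu>" "snd p \<in> Xc \<mu>" "Xn \<mu> (fst p) \<le> 1" "Xn \<mu> (snd p) \<le> 1"
      using that by (auto simp: slice_def)
    then show ?thesis using Xn_triangle_diff[of "fst p" "snd p"] by simp
  qed
  then have "bdd_above ((\<lambda>p. Xn \<mu> (\<lambda>k j. fst p k j - snd p k j)) ` ?S)"
    by (rule bdd_aboveI2)
  moreover have "?S \<noteq> {}" using assms by simp
  ultimately show ?thesis
    by (subst le_cSUP_iff) auto
qed

lemma LDP_iff_slices:
  "LDP \<delta> \<mu> \<longleftrightarrow> (\<forall>F \<alpha> c. dual_sphere \<mu> F \<and> 0 < \<alpha> \<and> c < \<delta> \<longrightarrow>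
    (\<exists>s\<in>slice \<mu> F \<alpha>. \<exists>t\<in>slice \<mu> F \<alpha>. c < Xn \<mu> (\<lambda>k j. s k j - t k j)))"
proof -
  have "slice \<mu> F \<alpha> \<noteq> {}" if "dual_sphere \<mu> F" "0 < \<alpha>" for F \<alpha>
    using dual_sphere_almost_attained[OF that(1), of "1 - \<alpha>"] that(2)
    by (auto simp: slice_def Xc_ball_def)
  from slice_diameter_ge_iff[OF this] show ?thesis
    unfolding LDP_def by (simp add: imp_conjL cong: imp_cong)
qed

lemma slice_if_scaled:
  assumes F: "dual_sphere \<mu> F" and "\<mu> v < r" "(1 - \<alpha>) * r < F (to_Xc v)"
  shows "(\<lambda>k j. (1 / r) * to_Xc v k j) \<in> slice \<mu> F \<alpha>"
proof -
  have r: "0 < r" using nonneg[of v] assms(2) by linarith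
  have "Xn \<mu> (\<lambda>k j. (1 / r) * to_Xc v k j) = \<mu> v / r"
    using r Xn_scale[of "to_Xc v" "1 / r"] by simp
  moreover have "F (\<lambda>k j. (1 / r) * to_Xc v k j) = F (to_Xc v) / r"
    using Xc_linear_scale[OF dual_sphere_linear[OF F], of "to_Xc v" "1 / r"] by simp
  ultimately show ?thesis
    using r assms(2,3) Xc_scale[of "to_Xc v" "1 / r"] by (simp add: slice_def pos_less_divide_eq)
qed

lemma LDP_if_norming_far_pairs:
  assumes far: "\<And>c. c < \<delta> \<Longrightarrow> norming_set \<mu> (far_pairs \<mu> c)"
  shows "LDP \<delta> \<mu>"
  unfolding LDP_iff_slices
proof (intro allI impI, elim conjE)
  fix F and \<alpha> c :: real assume F: "dual_sphere \<mu> F" and \<alpha>: "0 < \<alpha>" and c: "c < \<delta>"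
  have f: "norming \<mu> (\<lambda>v. F (to_Xc v))"
    by (rule norming_restrict_dual_sphere[OF F])
  have "(1 + (1 - \<alpha>)) / 2 < 1" using \<alpha> by simp
  then obtain R u where "(R, u) \<in> far_pairs \<mu> c" "(1 + (1 - \<alpha>)) / 2 * R < F (to_Xc u)"
    by (rule norming_setE[OF far[OF c] f])
  with f obtain r a b where rab: "\<mu> a < r" "\<mu> b < r" "(1 - \<alpha>) * r < F (to_Xc a)"
    "(1 - \<alpha>) * r < F (to_Xc b)" "c * r < \<mu> (a - b)"
    unfolding norming_def by (blast elim: far_pairs_slice)
  have r: "0 < r" using nonneg[of a] rab(1) by linarith
  have "Xn \<mu> (\<lambda>k j. (1 / r) * to_Xc (a - b) k j) = \<mu> (a - b) / r"
    using r Xn_scale[of "to_Xc (a - b)" "1 / r"] by simp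
  then have far_scaled: "c < Xn \<mu> (\<lambda>k j. (1 / r) * to_Xc a k j - (1 / r) * to_Xc b k j)"
    using r rab(5) by (simp add: to_Xc_diff diff_divide_distrib pos_less_divide_eq)
  show "\<exists>s\<in>slice \<mu> F \<alpha>. \<exists>t\<in>slice \<mu> F \<alpha>. c < Xn \<mu> (\<lambda>k j. s k j - t k j)"
    by (rule bexI[OF _ slice_if_scaled[OF F rab(1,3)]],
        rule bexI[OF _ slice_if_scaled[OF F rab(2,4)]], rule far_scaled)
qed

lemma far_pair_approximating:
  assumes f: "Modules.additive f" "contraction f"
    and x: "x \<in> Xc_ball \<mu>" "s < Xn f x" and y: "y \<in> Xc_ball \<mu>" "s < Xn f y"
    and far: "c < Xn \<mu> (\<lambda>k j. x k j - y k j)"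
  shows "\<exists>(R, u)\<in>far_pairs \<mu> c. s * R < f u"
proof -
  have Xc: "x \<in> Xc \<mu>" "y \<in> Xc \<mu>" and le_1: "Xn \<mu> x \<le> 1" "Xn \<mu> y \<le> 1"
    using x(1) y(1) by (auto simp: Xc_ball_def)
  obtain a b where a: "approximates a x" and b: "approximates b y"
    using approximates_exists Xc by metis
  define r where "r n = max 1 (max (\<mu> (a n)) (\<mu> (b n))) + 1 / real (Suc n)" for n
  have r_greater: "\<mu> (a n) < r n" "\<mu> (b n) < r n" for n
  proof -
    have "0 < 1 / real (Suc n)" by simp
    then show "\<mu> (a n) < r n" "\<mu> (b n) < r n" unfolding r_def by linarith+
  qed
  have "r \<longlonglongrightarrow> max 1 (max (Xn \<mu> x) (Xn \<mu> y)) + 0"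
    unfolding r_def
    by (intro tendsto_add[OF _ LIMSEQ_Suc[OF lim_1_over_n]] tendsto_max tendsto_const tendsto_Xn
        contraction_self Xc a b)
  then have r_lim: "r \<longlonglongrightarrow> 1" using le_1 by simp
  have "(\<lambda>n. f (a n) + f (b n) - s * (2 * r n)) \<longlonglongrightarrow> Xn f x + Xn f y - s * (2 * 1)"
    by (intro tendsto_intros tendsto_Xn f(2) Xc a b r_lim)
  then have "\<forall>\<^sub>F n in sequentially. 0 < f (a n) + f (b n) - s * (2 * r n)"
    by (rule order_tendstoD) (use x(2) y(2) in simp)
  moreover have "(\<lambda>n. \<mu> (a n - b n) - c * r n) \<longlonglongrightarrow> Xn \<mu> (\<lambda>k j. x k j - y k j) - c * 1"
    by (intro tendsto_intros tendsto_Xn contraction_self Xc_diff approximates_diff Xc a b r_lim)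
  then have "\<forall>\<^sub>F n in sequentially. 0 < \<mu> (a n - b n) - c * r n"
    by (rule order_tendstoD) (use far in simp)
  ultimately have "\<forall>\<^sub>F n in sequentially. s * (2 * r n) < f (a n + b n) \<and> c * r n < \<mu> (a n - b n)"
    by eventually_elim (simp add: additive.add[OF f(1)])
  then obtain n where "s * (2 * r n) < f (a n + b n)" "c * r n < \<mu> (a n - b n)"
    by (auto simp: eventually_sequentially)
  then show ?thesis
    using r_greater[of n] by (intro bexI[of _ "(2 * r n, a n + b n)"]) (auto simp: far_pairs_def)
qed

lemma norming_far_pairs_if_LDP:
  assumes LDP: "LDP \<delta> \<mu>" and c: "c < \<delta>"
  shows "norming_set \<mu> (far_pairs \<mu> c)"
  unfolding norming_set_def
proof (intro allI impI, elim conjE)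
  fix f and s :: real assume f: "norming \<mu> f" and s: "s < 1"
  have additive: "Modules.additive f" and contr: "contraction f"
    using f contraction_additive by (auto simp: norming_def)
  have "dual_sphere \<mu> (Xn f) \<and> 0 < 1 - s \<and> c < \<delta>"
    using dual_sphere_extend_norming[OF f] s c by simp
  with LDP obtain x y where "x \<in> slice \<mu> (Xn f) (1 - s)" "y \<in> slice \<mu> (Xn f) (1 - s)"
    and far: "c < Xn \<mu> (\<lambda>k j. x k j - y k j)"
    unfolding LDP_iff_slices by blast
  then have "x \<in> Xc_ball \<mu>" "s < Xn f x" "y \<in> Xc_ball \<mu>" "s < Xn f y"
    by (auto simp: slice_def Xc_ball_def)
  with additive contr show "\<exists>(R, u)\<in>far_pairs \<mu> c. s * R < f u"
    using far by (rule far_pair_approximating)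
qed

lemma LDP_iff_norming_far_pairs: "LDP \<delta> \<mu> \<longleftrightarrow> (\<forall>c<\<delta>. norming_set \<mu> (far_pairs \<mu> c))"
  using LDP_if_norming_far_pairs norming_far_pairs_if_LDP by blast

end

subsection \<open>Duality between norming sets and convex hulls\<close>

definition half_closed :: "(real \<times> V) set \<Rightarrow> bool" where
  "half_closed T \<longleftrightarrow> (\<forall>(r, u)\<in>T. 0 \<le> r \<and> (r / 2, qscale (1 / 2) u) \<in> T)"

lemma half_closed_nonneg: "half_closed T \<Longrightarrow> (r, u) \<in> T \<Longrightarrow> 0 \<le> r"
  and half_closed_half: "half_closed T \<Longrightarrow> (r, u) \<in> T \<Longrightarrow> (r / 2, qscale (1 / 2) u) \<in> T"
  by (auto simp: half_closed_def)

definition hull_cost :: "(V \<Rightarrow> real) \<Rightarrow> V \<Rightarrow> (real \<times> V) list \<Rightarrow> real" where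
  "hull_cost \<mu> v l = sum_list (map fst l) + 2 * \<mu> (v - sum_list (map snd l))"

text \<open>A pair \<open>(r, u)\<close> stands for the point \<open>u / r\<close>, so the gauge is the largest sublinear functional
  that is at most 1 at these points and at most \<open>2 * \<mu>\<close> everywhere. The factor 2 could be any
  constant above 1.\<close>

definition hull_gauge :: "(V \<Rightarrow> real) \<Rightarrow> (real \<times> V) set \<Rightarrow> V \<Rightarrow> real" where
  "hull_gauge \<mu> T v = (INF l\<in>lists T. hull_cost \<mu> v l)"

lemma hull_gauge_greatest: "(\<And>l. l \<in> lists T \<Longrightarrow> x \<le> hull_cost \<mu> v l) \<Longrightarrow> x \<le> hull_gauge \<mu> T v"
  unfolding hull_gauge_def by (rule cINF_greatest) auto

context seminorm_on_V
begin

lemma hull_cost_append: "hull_cost \<mu> (v + w) (l @ l') \<le> hull_cost \<mu> v l + hull_cost \<mu> w l'"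
  using triangle[of "v - sum_list (map snd l)" "w - sum_list (map snd l')"]
  by (simp add: hull_cost_def add_diff_add)

lemma hull_cost_halve:
  "hull_cost \<mu> (v + v) l = 2 * hull_cost \<mu> v (map (\<lambda>(r, u). (r / 2, qscale (1 / 2) u)) l)"
proof -
  let ?h = "qscale (1 / 2)" and ?H = "map (\<lambda>(r, u). (r / 2, qscale (1 / 2) u))"
  have sums: "sum_list (map fst (?H l)) = sum_list (map fst l) / 2"
    "sum_list (map snd (?H l)) = ?h (sum_list (map snd l))"
    by (induction l) (auto simp: qscale_add_right qscale_zero_right add_divide_distrib)
  have "?h (v + v - sum_list (map snd l)) = ?h v + ?h v - ?h (sum_list (map snd l))"
    by (simp only: qscale_diff_right qscale_add_right)
  also have "?h v + ?h v = v"
    using qscale_add_left[of "1 / 2" "1 / 2" v] by (simp add: qscale_one)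
  finally have "\<mu> (v - ?h (sum_list (map snd l))) = \<mu> (v + v - sum_list (map snd l)) / 2"
    using scale[of "1 / 2" "v + v - sum_list (map snd l)"] by (simp add: of_rat_divide)
  then show ?thesis unfolding hull_cost_def sums by simp
qed

lemma bdd_below_hull_cost:
  assumes "half_closed T"
  shows "bdd_below (hull_cost \<mu> v ` lists T)"
proof (rule bdd_belowI2)
  fix l assume "l \<in> lists T"
  then have "0 \<le> sum_list (map fst l)"
    using half_closed_nonneg[OF assms] by (intro sum_list_nonneg) auto
  then show "0 \<le> hull_cost \<mu> v l" by (simp add: hull_cost_def)
qed

lemma hull_gauge_le: "half_closed T \<Longrightarrow> l \<in> lists T \<Longrightarrow> hull_gauge \<mu> T v \<le> hull_cost \<mu> v l"
  unfolding hull_gauge_def by (rule cINF_lower[OF bdd_below_hull_cost])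

lemma hull_gauge_less_iff:
  "half_closed T \<Longrightarrow> hull_gauge \<mu> T v < x \<longleftrightarrow> (\<exists>l\<in>lists T. hull_cost \<mu> v l < x)"
  unfolding hull_gauge_def by (rule cINF_less_iff[OF _ bdd_below_hull_cost]) auto

lemma hull_gauge_antimono:
  assumes "half_closed U" "T \<subseteq> U"
  shows "hull_gauge \<mu> U v \<le> hull_gauge \<mu> T v"
  using assms lists_mono by (intro hull_gauge_greatest hull_gauge_le) auto

lemma hull_gauge_le_twice: "half_closed T \<Longrightarrow> hull_gauge \<mu> T v \<le> 2 * \<mu> v"
  using hull_gauge_le[of T "[]" v] by (simp add: hull_cost_def)

lemma hull_gauge_le_weight: "half_closed T \<Longrightarrow> (r, u) \<in> T \<Longrightarrow> hull_gauge \<mu> T u \<le> r"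
  using hull_gauge_le[of T "[(r, u)]" u] by (simp add: hull_cost_def)

lemma sublinear_hull_gauge:
  assumes T: "half_closed T"
  shows "sublinear (hull_gauge \<mu> T)"
proof (rule sublinearI)
  fix v w
  have "hull_gauge \<mu> T (v + w) \<le> hull_cost \<mu> v l + hull_cost \<mu> w l'"
    if "l \<in> lists T" "l' \<in> lists T" for l l'
    using hull_gauge_le[OF T, of "l @ l'" "v + w"] hull_cost_append[of v w l l'] that by simp
  then have "hull_gauge \<mu> T (v + w) - hull_cost \<mu> w l' \<le> hull_gauge \<mu> T v" if "l' \<in> lists T" for l'
    using that by (intro hull_gauge_greatest) (simp add: diff_le_eq)
  then have "hull_gauge \<mu> T (v + w) - hull_gauge \<mu> T v \<le> hull_gauge \<mu> T w"
    by (intro hull_gauge_greatest) (simp add: algebra_simps)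
  then show "hull_gauge \<mu> T (v + w) \<le> hull_gauge \<mu> T v + hull_gauge \<mu> T w" by simp
next
  fix v
  show "2 * hull_gauge \<mu> T v \<le> hull_gauge \<mu> T (v + v)"
  proof (rule hull_gauge_greatest)
    fix l assume "l \<in> lists T"
    then have "map (\<lambda>(r, u). (r / 2, qscale (1 / 2) u)) l \<in> lists T"
      using half_closed_half[OF T] by auto
    then show "2 * hull_gauge \<mu> T v \<le> hull_cost \<mu> (v + v) l"
      unfolding hull_cost_halve using hull_gauge_le[OF T] by simp
  qed
qed

lemma additive_le_hull_gauge:
  assumes f: "Modules.additive f" and le: "\<And>v. f v \<le> 2 * \<mu> v"
    and T: "\<And>r u. (r, u) \<in> T \<Longrightarrow> f u \<le> r"
  shows "f v \<le> hull_gauge \<mu> T v"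
proof (rule hull_gauge_greatest)
  interpret Modules.additive f by (rule f)
  fix l assume "l \<in> lists T"
  then have "f (sum_list (map snd l)) \<le> sum_list (map fst l)"
    by (induction l) (auto simp: zero add intro!: add_mono T)
  then show "f v \<le> hull_cost \<mu> v l"
    using le[of "v - sum_list (map snd l)"] by (simp add: hull_cost_def diff)
qed

text \<open>Vectors with \<open>\<mu> u = 0\<close> contribute \<open>f u / 0 = 0\<close> to the supremum.\<close>

definition dual_norm :: "(V \<Rightarrow> real) \<Rightarrow> real" where
  "dual_norm f = (SUP u. f u / \<mu> u)"

lemma bdd_above_ratio:
  assumes "0 \<le> K" "\<And>u. f u \<le> K * \<mu> u"
  shows "bdd_above (range (\<lambda>u. f u / \<mu> u))"
proof (rule bdd_aboveI2)
  show "f u / \<mu> u \<le> K" for u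
    using assms(1) assms(2)[of u] nonneg[of u] by (auto simp: divide_le_eq less_le)
qed

lemma le_dual_norm:
  assumes "0 \<le> K" "\<And>u. f u \<le> K * \<mu> u"
  shows "f u \<le> dual_norm f * \<mu> u"
proof (cases "\<mu> u = 0")
  case True
  then show ?thesis using assms(2)[of u] by simp
next
  case False
  then have "0 < \<mu> u" using nonneg[of u] by linarith
  moreover have "f u / \<mu> u \<le> dual_norm f"
    unfolding dual_norm_def by (rule cSUP_upper[OF UNIV_I bdd_above_ratio[OF assms]])
  ultimately show ?thesis by (simp add: divide_le_eq)
qed

lemma norming_divide_dual_norm:
  assumes f: "Modules.additive f" and K: "0 \<le> K" "\<And>u. f u \<le> K * \<mu> u" and pos: "0 < dual_norm f"
  shows "norming \<mu> (\<lambda>u. f u / dual_norm f)"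
  unfolding norming_def
proof (intro conjI allI impI)
  show "Modules.additive (\<lambda>u. f u / dual_norm f)"
    by unfold_locales (simp add: additive.add[OF f] add_divide_distrib)
  show "f u / dual_norm f \<le> \<mu> u" for u
    using le_dual_norm[OF K] pos by (simp add: divide_le_eq mult.commute)
  fix s :: real assume s: "0 \<le> s \<and> s < 1"
  then have "s * dual_norm f < (SUP u. f u / \<mu> u)"
    using pos by (simp flip: dual_norm_def)
  then obtain u where u: "s * dual_norm f < f u / \<mu> u"
    unfolding less_cSUP_iff[OF UNIV_not_empty bdd_above_ratio[OF K]] by blast
  moreover have "0 \<le> s * dual_norm f" using s pos by simp
  ultimately have "\<mu> u \<noteq> 0" by auto
  then have "0 < \<mu> u" using nonneg[of u] by linarith
  then have "s * \<mu> u < f u / dual_norm f"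
    using u pos by (simp add: pos_less_divide_eq ac_simps)
  then show "\<exists>u. s * \<mu> u < f u / dual_norm f" by blast
qed

lemma hull_gauge_le_if_norming_set:
  assumes T: "half_closed T" and norming: "norming_set \<mu> T"
  shows "hull_gauge \<mu> T v \<le> \<mu> v"
proof (rule ccontr)
  assume v: "\<not> hull_gauge \<mu> T v \<le> \<mu> v"
  obtain f where f: "Modules.additive f" "f \<le> hull_gauge \<mu> T" "f v = hull_gauge \<mu> T v"
    using Hahn_Banach_group[OF sublinear_hull_gauge[OF T]] by blast
  have f_le: "f u \<le> 2 * \<mu> u" for u
    using le_funD[OF f(2)] hull_gauge_le_twice[OF T] by (rule order_trans)
  have "1 * \<mu> v < dual_norm f * \<mu> v"
    using v f(3) le_dual_norm[OF _ f_le, of v] by simp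
  then have dual_norm: "1 < dual_norm f"
    by (rule mult_right_less_imp_less) simp
  then have "norming \<mu> (\<lambda>u. f u / dual_norm f)" "1 / dual_norm f < 1"
    using norming_divide_dual_norm[OF f(1) _ f_le] by simp_all
  then obtain r u where ru: "(r, u) \<in> T" "1 / dual_norm f * r < f u / dual_norm f"
    by (rule norming_setE[OF norming])
  then have "r < f u" using dual_norm by (simp add: divide_less_cancel)
  also have "\<dots> \<le> hull_gauge \<mu> T u" using f(2) by (rule le_funD)
  also have "\<dots> \<le> r" by (rule hull_gauge_le_weight[OF T ru(1)])
  finally show False by simp
qed

lemma norming_set_if_hull_gauge_le:
  assumes T: "half_closed T" and hull_gauge: "\<And>v. hull_gauge \<mu> T v \<le> \<mu> v"
  shows "norming_set \<mu> T"
  unfolding norming_set_def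
proof (intro allI impI, elim conjE)
  fix f and s :: real assume f: "norming \<mu> f" and s: "s < 1"
  have additive: "Modules.additive f" and f_le: "\<And>v. f v \<le> \<mu> v"
    using f by (simp_all add: norming_def)
  define s' where "s' = max s (1 / 2)"
  have s': "1 / 2 \<le> s'" "s \<le> s'" "s' < 1" using s by (auto simp: s'_def)
  show "\<exists>(r, u)\<in>T. s * r < f u"
  proof (rule ccontr)
    assume none: "\<not> ?thesis"
    have "f v / s' \<le> hull_gauge \<mu> T v" for v
    proof (rule additive_le_hull_gauge)
      show "Modules.additive (\<lambda>v. f v / s')"
        by unfold_locales (simp add: additive.add[OF additive] add_divide_distrib)
      show "f v / s' \<le> 2 * \<mu> v" for v
      proof -
        have "1 * \<mu> v \<le> (2 * s') * \<mu> v" using s'(1) by (intro mult_right_mono) auto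
        then have "f v \<le> (2 * s') * \<mu> v" using f_le[of v] by simp
        then show ?thesis using s'(1) by (simp add: divide_le_eq ac_simps)
      qed
      fix r u assume ru: "(r, u) \<in> T"
      then have "f u \<le> s * r" using none by (auto simp: not_less)
      also have "\<dots> \<le> s' * r"
        using s'(2) half_closed_nonneg[OF T ru] by (rule mult_right_mono)
      finally show "f u / s' \<le> r" using s'(1) by (simp add: divide_le_eq ac_simps)
    qed
    then have "f v / s' \<le> \<mu> v" for v
      using hull_gauge by (rule order_trans)
    then have "f v \<le> s' * \<mu> v" for v
      using s'(1) by (simp add: divide_le_eq ac_simps)
    moreover have "0 \<le> s'" using s'(1) by simp
    ultimately show False
      using f s'(3) unfolding norming_def by (meson leD)
  qed
qed

lemma half_closed_far_pairs: "half_closed (far_pairs \<mu> c)"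
  unfolding half_closed_def
proof (intro ballI, clarify)
  fix R u assume "(R, u) \<in> far_pairs \<mu> c"
  then obtain r a b where rab: "R = 2 * r" "u = a + b" "\<mu> a < r" "\<mu> b < r" "c * r < \<mu> (a - b)"
    by (auto simp: far_pairs_def)
  let ?h = "qscale (1 / 2)"
  have "0 \<le> R" using nonneg[of a] rab(1,3) by linarith
  moreover have "\<mu> (?h a) < r / 2" "\<mu> (?h b) < r / 2" "c * (r / 2) < \<mu> (?h a - ?h b)"
    using rab(3-5) by (simp_all add: scale of_rat_divide flip: qscale_diff_right)
  then have "(2 * (r / 2), ?h a + ?h b) \<in> far_pairs \<mu> c"
    unfolding far_pairs_def by blast
  then have "(R / 2, ?h u) \<in> far_pairs \<mu> c"
    by (simp add: rab(1,2) qscale_add_right)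
  ultimately show "0 \<le> R \<and> (R / 2, ?h u) \<in> far_pairs \<mu> c" by simp
qed

lemma far_pairs_antimono:
  assumes "c \<le> d"
  shows "far_pairs \<mu> d \<subseteq> far_pairs \<mu> c"
proof -
  have "c * r < \<mu> (a - b)" if "\<mu> a < r" "d * r < \<mu> (a - b)" for r a b
    using that nonneg[of a] mult_right_mono[OF assms, of r] by linarith
  then show ?thesis unfolding far_pairs_def by blast
qed

lemma LDP_iff_hull_gauge_le: "LDP \<delta> \<mu> \<longleftrightarrow> (\<forall>c<\<delta>. \<forall>v. hull_gauge \<mu> (far_pairs \<mu> c) v \<le> \<mu> v)"
  unfolding LDP_iff_norming_far_pairs
  using hull_gauge_le_if_norming_set norming_set_if_hull_gauge_le half_closed_far_pairs by blast

lemma LDP_iff_rational_hull_cost: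
  "LDP \<delta> \<mu> \<longleftrightarrow> (\<forall>q v n. real_of_rat q < \<delta> \<longrightarrow>
    (\<exists>l\<in>lists (far_pairs \<mu> (of_rat q)). hull_cost \<mu> v l < \<mu> v + 1 / real (Suc n)))"
proof -
  have "hull_gauge \<mu> (far_pairs \<mu> c) v \<le> \<mu> v"
    if rational: "\<And>q. of_rat q < \<delta> \<Longrightarrow> hull_gauge \<mu> (far_pairs \<mu> (of_rat q)) v \<le> \<mu> v"
      and c: "c < \<delta>" for c v
  proof -
    obtain q where q: "c < of_rat q" "of_rat q < \<delta>" using of_rat_dense[OF c] by blast
    have "hull_gauge \<mu> (far_pairs \<mu> c) v \<le> hull_gauge \<mu> (far_pairs \<mu> (of_rat q)) v"
      using q(1) by (intro hull_gauge_antimono half_closed_far_pairs far_pairs_antimono) simp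
    also have "\<dots> \<le> \<mu> v" by (rule rational[OF q(2)])
    finally show ?thesis .
  qed
  then have "LDP \<delta> \<mu> \<longleftrightarrow> (\<forall>q v. real_of_rat q < \<delta> \<longrightarrow> hull_gauge \<mu> (far_pairs \<mu> (of_rat q)) v \<le> \<mu> v)"
    unfolding LDP_iff_hull_gauge_le by blast
  moreover have "x \<le> y \<longleftrightarrow> (\<forall>n. x < y + 1 / real (Suc n))" for x y :: real
    using nat_approx_posE[of "x - y"]
    by (smt (verit) divide_pos_pos of_nat_0_less_iff zero_less_Suc)
  ultimately show ?thesis
    by (simp add: hull_gauge_less_iff half_closed_far_pairs)
qed

end

subsection \<open>The condition is G-delta\<close>

lemma sum_single_lookup:
  fixes v :: "'a \<Rightarrow>\<^sub>0 'b::comm_monoid_add"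
  shows "(\<Sum>i\<in>Poly_Mapping.keys v. Poly_Mapping.single i (Poly_Mapping.lookup v i)) = v"
  by (intro poly_mapping_eqI) (auto simp: lookup_sum lookup_single when_def in_keys_iff)

lemma countable_poly_mapping:
  "countable (UNIV :: ('a::countable \<Rightarrow>\<^sub>0 'b::{countable, comm_monoid_add}) set)"
proof -
  define g :: "('a \<times> 'b) list \<Rightarrow> 'a \<Rightarrow>\<^sub>0 'b" where
    "g l = (\<Sum>(i, q)\<leftarrow>l. Poly_Mapping.single i q)" for l
  have "v \<in> range g" for v
  proof -
    obtain ks where ks: "set ks = Poly_Mapping.keys v" "distinct ks"
      using finite_distinct_list[OF finite_keys[of v]] by blast
    then have "g (map (\<lambda>i. (i, Poly_Mapping.lookup v i)) ks) = v"
      by (simp add: g_def comp_def sum_list_distinct_conv_sum_set sum_single_lookup)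
    then show ?thesis by (rule range_eqI[OF sym])
  qed
  then have "UNIV \<subseteq> range g" by blast
  then show ?thesis by (rule countable_subset) simp
qed

lemma open_far_pairs: "open {\<mu> :: V \<Rightarrow> real. p \<in> far_pairs \<mu> c}"
proof -
  have "open {\<mu> :: V \<Rightarrow> real. \<exists>r a b. p = (2 * r, a + b) \<and> \<mu> a < r \<and> \<mu> b < r \<and> c * r < \<mu> (a - b)}"
    by (intro open_Collect_ex open_Collect_conj open_Collect_const open_Collect_less
        continuous_on_const continuous_on_product_coordinates)
  then show ?thesis by (simp add: far_pairs_def)
qed

lemma open_hull_cost_less:
  fixes c \<eta> :: real
  shows "open {\<mu> :: V \<Rightarrow> real. \<exists>l\<in>lists (far_pairs \<mu> c). hull_cost \<mu> v l < \<mu> v + \<eta>}"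
proof -
  have "open {\<mu> :: V \<Rightarrow> real. l \<in> lists (far_pairs \<mu> c)}" for l
    by (induction l) (auto intro: open_Collect_conj open_far_pairs)
  moreover have "open {\<mu> :: V \<Rightarrow> real. hull_cost \<mu> v l < \<mu> v + \<eta>}" for l
    unfolding hull_cost_def
    by (intro open_Collect_less continuous_intros continuous_on_product_coordinates)
  ultimately show ?thesis unfolding Bex_def by (intro open_Collect_ex open_Collect_conj)
qed

lemma gdelta_LDP:
  assumes "I \<subseteq> Pset"
  shows "gdelta_in (top_of_set I) {\<mu> \<in> I. LDP \<delta> \<mu>}"
proof -
  define U where "U = (\<lambda>(q, v, n). {\<mu> :: V \<Rightarrow> real. real_of_rat q < \<delta> \<longrightarrow>
    (\<exists>l\<in>lists (far_pairs \<mu> (of_rat q)). hull_cost \<mu> v l < \<mu> v + 1 / real (Suc n))})"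
  have "open (U p)" for p
    unfolding U_def by (cases p) (auto intro: open_hull_cost_less open_Collect_imp)
  moreover have "countable (range U)"
    by (intro countable_image) (simp add: countable_poly_mapping flip: UNIV_Times_UNIV)
  ultimately have "gdelta_in euclidean (\<Inter>(range U))"
    by (intro gdelta_in_Inter) (auto intro: open_imp_gdelta_in)
  then have "gdelta_in (top_of_set I) (I \<inter> \<Inter>(range U))"
    unfolding gdelta_in_subtopology by blast
  moreover have "LDP \<delta> \<mu> \<longleftrightarrow> \<mu> \<in> \<Inter>(range U)" if "\<mu> \<in> I" for \<mu>
  proof -
    interpret seminorm_on_V \<mu> using assms that by unfold_locales (auto simp: Pset_def)
    show ?thesis unfolding LDP_iff_rational_hull_cost U_def by auto
  qed
  then have "{\<mu> \<in> I. LDP \<delta> \<mu>} = I \<inter> \<Inter>(range U)" by blast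
  ultimately show ?thesis by simp
qed

subsection \<open>Criteria for the slice condition and for membership in Bset\<close>

definition proj :: "nat set \<Rightarrow> V \<Rightarrow> V" where
  "proj A v = Poly_Mapping.mapp (\<lambda>i q. if i \<in> A then q else 0) v"

lemma lookup_proj [simp]: "lookup (proj A v) i = (if i \<in> A then lookup v i else 0)"
  by (simp add: proj_def lookup_mapp when_def in_keys_iff)

lemma emb_proj: "emb (proj A v) i = (if i \<in> A then emb v i else 0)"
  by (simp add: emb_def)

lemma keys_proj: "keys (proj A v) = keys v \<inter> A"
  by (auto simp: in_keys_iff split: if_splits)

lemma proj_add: "proj A (v + w) = proj A v + proj A w"
  and proj_diff: "proj A (v - w) = proj A v - proj A w"
  and proj_qscale: "proj A (qscale q v) = qscale q (proj A v)"
  and proj_proj: "proj A (proj B v) = proj (A \<inter> B) v"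
  and proj_singleton: "proj {i} v = qscale (lookup v i) (single i 1)"
  by (auto intro!: poly_mapping_eqI simp: lookup_add lookup_minus lookup_single)

lemma proj_eq_self: "keys v \<subseteq> A \<Longrightarrow> proj A v = v"
  and proj_eq_0: "keys v \<inter> A = {} \<Longrightarrow> proj A v = 0"
  by (auto intro!: poly_mapping_eqI simp: in_keys_iff disjoint_iff)

context seminorm_on_V
begin

lemma LDP_if_perturbable:
  assumes localize: "\<And>f s v. Modules.additive f \<Longrightarrow> s * \<mu> v < f v \<Longrightarrow> \<exists>z\<in>Z. s * \<mu> z < f z"
    and perturb: "\<And>z r c. z \<in> Z \<Longrightarrow> \<mu> z < r \<Longrightarrow> c < 2 \<Longrightarrow>
      \<exists>y. \<mu> (z + y) < r \<and> \<mu> (z - y) < r \<and> c * r < \<mu> (y + y)"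
    and \<delta>: "\<delta> \<le> 2"
  shows "LDP \<delta> \<mu>"
  unfolding LDP_iff_norming_far_pairs norming_set_def
proof (intro allI impI, elim conjE)
  fix c s :: real and f assume c: "c < \<delta>" and f: "norming \<mu> f" and s: "s < 1"
  have additive: "Modules.additive f" using f by (simp add: norming_def)
  define s' where "s' = max s (1 / 2)"
  have s': "0 < s'" "s \<le> s'" "s' < 1" using s by (auto simp: s'_def)
  then have "0 \<le> s' \<and> s' < 1" by simp
  then obtain v where "s' * \<mu> v < f v" using f unfolding norming_def by blast
  then obtain z where z: "z \<in> Z" "s' * \<mu> z < f z" using localize[OF additive] by blast
  then have "\<mu> z < f z / s'" using s'(1) by (simp add: pos_less_divide_eq mult.commute)
  then obtain r where r: "\<mu> z < r" "r < f z / s'" using dense by blast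
  obtain y where y: "\<mu> (z + y) < r" "\<mu> (z - y) < r" "c * r < \<mu> (y + y)"
    using perturb[OF z(1) r(1), of c] c \<delta> by auto
  have "(z + y) - (z - y) = y + y" by simp
  with y have "(2 * r, (z + y) + (z - y)) \<in> far_pairs \<mu> c"
    unfolding far_pairs_def by fastforce
  moreover have "s * (2 * r) < f ((z + y) + (z - y))"
  proof -
    have "0 < r" using r(1) nonneg[of z] by linarith
    then have "s * r \<le> s' * r" using s'(2) by simp
    also have "\<dots> < f z" using r(2) s'(1) by (simp add: pos_less_divide_eq mult.commute)
    finally show ?thesis
      by (simp only: additive.add[OF additive] additive.diff[OF additive])
  qed
  ultimately show "\<exists>(r, u)\<in>far_pairs \<mu> c. s * r < f u" by blast
qed

lemma not_LDP_if_L_summand: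
  assumes split: "\<And>v. \<mu> v = \<mu> (proj {i} v) + \<mu> (proj (- {i}) v)"
    and pos: "0 < \<mu> (single i 1)" and \<delta>: "0 < \<delta>"
  shows "\<not> LDP \<delta> \<mu>"
proof
  assume LDP: "LDP \<delta> \<mu>"
  define f where "f v = emb v i * \<mu> (single i 1)" for v
  have additive: "Modules.additive f"
    by unfold_locales (simp add: f_def emb_add distrib_right)
  have proj_i: "\<mu> (proj {i} v) = \<bar>f v\<bar>" for v
    by (simp add: proj_singleton scale f_def emb_def abs_mult)
  have le: "f v \<le> \<mu> v" for v
    using split[of v] proj_i[of v] nonneg[of "proj (- {i}) v"] by linarith
  have "s * \<mu> (single i 1) < f (single i 1)" if "s < 1" for s
    using that pos by (simp add: f_def emb_single)
  then have norming: "norming \<mu> f"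
    unfolding norming_def using additive le by blast
  have "norming_set \<mu> (far_pairs \<mu> (\<delta> / 2))"
    using LDP \<delta> by (simp add: LDP_iff_norming_far_pairs)
  then obtain R u where "(R, u) \<in> far_pairs \<mu> (\<delta> / 2)" "(1 + (1 - \<delta> / 6)) / 2 * R < f u"
    by (rule norming_setE[OF _ norming, of _ "(1 + (1 - \<delta> / 6)) / 2"]) (simp add: \<delta>)
  from far_pairs_slice[OF additive le this] obtain r a b where
    rab: "\<mu> a < r" "\<mu> b < r" "(1 - \<delta> / 6) * r < f a" "(1 - \<delta> / 6) * r < f b"
      "\<delta> / 2 * r < \<mu> (a - b)" .
  have complement: "\<mu> (proj (- {i}) v) < \<delta> / 6 * r" if "\<mu> v < r" "(1 - \<delta> / 6) * r < f v" for v
    using split[of v] proj_i[of v] that by (simp add: algebra_simps)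
  have "\<mu> (a - b) = \<bar>f a - f b\<bar> + \<mu> (proj (- {i}) a - proj (- {i}) b)"
    using split[of "a - b"] unfolding proj_i by (simp only: proj_diff additive.diff[OF additive])
  also have "\<dots> \<le> \<bar>f a - f b\<bar> + (\<mu> (proj (- {i}) a) + \<mu> (proj (- {i}) b))"
    by (intro add_left_mono triangle_diff)
  also have "\<dots> < \<delta> / 6 * r + (\<delta> / 6 * r + \<delta> / 6 * r)"
  proof (intro add_strict_mono complement rab)
    show "\<bar>f a - f b\<bar> < \<delta> / 6 * r"
      using rab(1-4) le[of a] le[of b] unfolding left_diff_distrib by linarith
  qed
  finally show False using rab(5) by simp
qed

lemma Bset_if_coords_le:
  assumes w: "\<And>i. 0 < w i" and le: "\<And>i v. w i * \<bar>emb v i\<bar> \<le> \<mu> v"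
  shows "\<mu> \<in> Bset"
proof -
  have "w i * \<bar>x i\<bar> \<le> mubar \<mu> x" if x: "x \<in> c00" for x i
  proof (rule LIMSEQ_le[OF _ tendsto_mubar_rnd[OF contraction_self x]])
    show "(\<lambda>k. w i * \<bar>emb (rnd k x) i\<bar>) \<longlonglongrightarrow> w i * \<bar>x i\<bar>"
      using c00_tendsto_rnd[OF x] by (intro tendsto_intros) (simp add: c00_tendsto_def)
  qed (simp add: le)
  then have norm: "x i = 0" if "x \<in> c00" "mubar \<mu> x = 0" for x i
    using that w[of i] by (metis abs_ge_zero abs_le_zero_iff mult_le_0_iff not_le)
  have "infdimX \<mu>"
    unfolding infdimX_def
  proof (intro allI exI conjI impI)
    fix n :: nat
    show "to_Xc (single i 1) \<in> Xc \<mu>" for i by (rule to_Xc_in_Xc)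
    fix c :: "nat \<Rightarrow> real" and i
    let ?x = "\<lambda>j. \<Sum>i<n. c i * emb (single i 1) j"
    assume zero: "Xn \<mu> (\<lambda>k j. \<Sum>i<n. c i * to_Xc (single i 1) k j) = 0" and i: "i < n"
    have x: "?x j = (if j < n then c j else 0)" for j
      by (simp add: emb_single if_distrib cong: if_cong)
    have "{j. ?x j \<noteq> 0} \<subseteq> {..<n}" unfolding x by auto
    then have "?x \<in> c00" unfolding c00_def mem_Collect_eq by (rule finite_subset) simp
    then have "?x i = 0" by (rule norm) (use zero in \<open>simp add: to_Xc_def Xn_const\<close>)
    then show "c i = 0" using i x by simp
  qed
  then show ?thesis
    unfolding Bset_def Pinf_def Pset_def using seminorm norm by auto
qed

end

subsection \<open>A family of norms\<close>

lemma seminormVI: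
  assumes nonneg: "\<And>v. 0 \<le> p v" and triangle: "\<And>v w. p (v + w) \<le> p v + p w"
    and scale: "\<And>q v. p (qscale q v) \<le> \<bar>of_rat q\<bar> * p v"
  shows "seminormV p"
proof -
  have "\<bar>of_rat q\<bar> * p v \<le> p (qscale q v)" for q v
  proof (cases "q = 0")
    case True
    then show ?thesis by (simp add: nonneg)
  next
    case False
    then have "p v \<le> \<bar>of_rat (1 / q)\<bar> * p (qscale q v)"
      using scale[of "1 / q" "qscale q v"] by (simp add: qscale_qscale qscale_one)
    then show ?thesis using False by (simp add: of_rat_divide field_simps)
  qed
  then show ?thesis
    unfolding seminormV_def using assms by (simp add: antisym)
qed

lemma seminormV_max_mult:
  assumes p: "seminormV p" and q: "seminormV q" and s: "0 \<le> s"
  shows "seminormV (\<lambda>v. max (p v) (s * q v))"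
proof -
  interpret p: seminorm_on_V p by unfold_locales (rule p)
  interpret q: seminorm_on_V q by unfold_locales (rule q)
  show ?thesis
  proof (rule seminormVI)
    show "0 \<le> max (p v) (s * q v)" for v by (simp add: le_max_iff_disj)
    show "max (p (v + w)) (s * q (v + w)) \<le> max (p v) (s * q v) + max (p w) (s * q w)" for v w
      using p.triangle[of v w] mult_left_mono[OF q.triangle[of v w] s]
      unfolding distrib_left by linarith
    show "max (p (qscale r v)) (s * q (qscale r v)) \<le> \<bar>of_rat r\<bar> * max (p v) (s * q v)" for r v
      by (simp add: p.scale q.scale max_mult_distrib_left mult.left_commute)
  qed
qed

definition wt :: "nat \<Rightarrow> real" where
  "wt i = (1 / 2) ^ i"

lemma wt_pos: "0 < wt i"
  by (simp add: wt_def)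

definition l1_norm :: "V \<Rightarrow> real" where
  "l1_norm v = (\<Sum>i\<in>keys v. wt i * \<bar>emb v i\<bar>)"

lemma l1_norm_eq:
  assumes "finite K" "keys v \<subseteq> K"
  shows "l1_norm v = (\<Sum>i\<in>K. wt i * \<bar>emb v i\<bar>)"
  unfolding l1_norm_def using assms by (intro sum.mono_neutral_left) (auto simp: emb_eq_0_iff)

lemma l1_norm_nonneg: "0 \<le> l1_norm v"
  unfolding l1_norm_def using wt_pos by (intro sum_nonneg) (simp add: less_imp_le)

lemma seminormV_l1_norm: "seminormV l1_norm"
proof (rule seminormVI[OF l1_norm_nonneg])
  fix v w
  let ?K = "keys v \<union> keys w"
  have "l1_norm (v + w) = (\<Sum>i\<in>?K. wt i * \<bar>emb v i + emb w i\<bar>)"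
    using l1_norm_eq[OF _ keys_add] by (simp add: emb_add)
  also have "\<dots> \<le> (\<Sum>i\<in>?K. wt i * \<bar>emb v i\<bar> + wt i * \<bar>emb w i\<bar>)"
    using wt_pos by (intro sum_mono) (simp add: less_imp_le abs_triangle_ineq flip: distrib_left)
  also have "\<dots> = l1_norm v + l1_norm w"
    by (simp add: sum.distrib l1_norm_eq[of ?K])
  finally show "l1_norm (v + w) \<le> l1_norm v + l1_norm w" .
next
  show "l1_norm (qscale q v) \<le> \<bar>of_rat q\<bar> * l1_norm v" for q v
    unfolding l1_norm_eq[OF finite_keys keys_qscale, of q v] l1_norm_def[of v] sum_distrib_left
    by (intro sum_mono) (simp add: emb_qscale abs_mult)
qed

lemma coord_le_l1_norm: "wt i * \<bar>emb v i\<bar> \<le> l1_norm v"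
proof (cases "i \<in> keys v")
  case True
  then show ?thesis
    unfolding l1_norm_def using wt_pos by (intro member_le_sum) (auto simp: less_imp_le)
next
  case False
  then show ?thesis using l1_norm_nonneg[of v] by (simp add: emb_eq_0_iff[THEN iffD2])
qed

lemma l1_norm_single: "l1_norm (single i q) = wt i * \<bar>of_rat q\<bar>"
  using l1_norm_eq[of "{i}" "single i q"] by (simp add: emb_single)

lemma l1_norm_split: "l1_norm v = l1_norm (proj A v) + l1_norm (proj (- A) v)"
proof -
  have "l1_norm (proj B v) = (\<Sum>i\<in>keys v. wt i * \<bar>emb (proj B v) i\<bar>)" for B
    by (intro l1_norm_eq) (auto simp: keys_proj)
  then show ?thesis
    unfolding l1_norm_def[of v] by (auto simp: emb_proj simp flip: sum.distrib intro: sum.cong)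
qed

definition sup_norm :: "V \<Rightarrow> real" where
  "sup_norm v = (SUP i. \<bar>emb v i\<bar>)"

lemma coord_le_sup_norm: "\<bar>emb v i\<bar> \<le> sup_norm v"
proof -
  have "range (\<lambda>i. \<bar>emb v i\<bar>) \<subseteq> insert 0 ((\<lambda>i. \<bar>emb v i\<bar>) ` keys v)"
    using emb_eq_0_iff by fastforce
  then have "finite (range (\<lambda>i. \<bar>emb v i\<bar>))"
    by (rule finite_subset) simp
  then show ?thesis
    unfolding sup_norm_def by (intro cSUP_upper bdd_above_finite) simp_all
qed

lemma sup_norm_le: "(\<And>i. \<bar>emb v i\<bar> \<le> c) \<Longrightarrow> sup_norm v \<le> c"
  unfolding sup_norm_def by (rule cSUP_least) simp_all

lemma sup_norm_nonneg: "0 \<le> sup_norm v"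
  using abs_ge_zero coord_le_sup_norm by (rule order_trans)

lemma seminormV_sup_norm: "seminormV sup_norm"
proof (rule seminormVI[OF sup_norm_nonneg])
  show "sup_norm (v + w) \<le> sup_norm v + sup_norm w" for v w
  proof (rule sup_norm_le)
    show "\<bar>emb (v + w) i\<bar> \<le> sup_norm v + sup_norm w" for i
      using coord_le_sup_norm[of v i] coord_le_sup_norm[of w i] by (simp add: emb_add)
  qed
  show "sup_norm (qscale q v) \<le> \<bar>of_rat q\<bar> * sup_norm v" for q v
    by (intro sup_norm_le) (simp add: emb_qscale abs_mult mult_left_mono coord_le_sup_norm)
qed

lemma sup_norm_add_single_le:
  assumes "i \<notin> keys v"
  shows "sup_norm (v + single i q) \<le> max (sup_norm v) \<bar>of_rat q\<bar>"
proof (rule sup_norm_le)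
  show "\<bar>emb (v + single i q) j\<bar> \<le> max (sup_norm v) \<bar>of_rat q\<bar>" for j
    using coord_le_sup_norm[of v j] assms
    by (auto simp: emb_add emb_single emb_eq_0_iff[THEN iffD2] le_max_iff_disj)
qed

definition mixed_norm :: "real \<Rightarrow> V \<Rightarrow> real" where
  "mixed_norm s v = max (l1_norm v) (s * sup_norm v)"

lemma seminormV_mixed_norm: "0 \<le> s \<Longrightarrow> seminormV (mixed_norm s)"
  unfolding mixed_norm_def by (rule seminormV_max_mult[OF seminormV_l1_norm seminormV_sup_norm])

lemma mixed_norm_nonneg: "0 \<le> mixed_norm s v"
  by (simp add: mixed_norm_def le_max_iff_disj l1_norm_nonneg)

lemma mixed_norm_zero_left: "mixed_norm 0 v = l1_norm v"
  by (simp add: mixed_norm_def l1_norm_nonneg)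

lemma l1_norm_le_mixed_norm: "l1_norm v \<le> mixed_norm s v"
  by (simp add: mixed_norm_def)

lemma mixed_norm_zero_right: "mixed_norm s 0 = 0"
  by (simp add: mixed_norm_def l1_norm_def sup_norm_def emb_zero)

lemma coord_le_mixed_norm:
  assumes "0 \<le> s"
  shows "s * \<bar>emb v i\<bar> \<le> mixed_norm s v"
  using mult_left_mono[OF coord_le_sup_norm assms] by (simp add: mixed_norm_def le_max_iff_disj)

lemma mixed_norm_add_single_less:
  assumes s: "0 \<le> s" and i: "i \<notin> keys v" and v: "mixed_norm s v < r"
    and q: "wt i * \<bar>of_rat q\<bar> < r - l1_norm v" "s * \<bar>of_rat q\<bar> < r"
  shows "mixed_norm s (v + single i q) < r"
proof -
  interpret l1: seminorm_on_V l1_norm by unfold_locales (rule seminormV_l1_norm)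
  have "l1_norm (v + single i q) < r"
    using l1.triangle[of v "single i q"] q(1) unfolding l1_norm_single by linarith
  moreover have "s * sup_norm (v + single i q) \<le> max (s * sup_norm v) (s * \<bar>of_rat q\<bar>)"
    using mult_left_mono[OF sup_norm_add_single_le[OF i, of q] s] s
    unfolding max_mult_distrib_left by simp
  ultimately show ?thesis using v q(2) unfolding mixed_norm_def by linarith
qed

text \<open>Far out in \<open>B\<close> the weights are so small that only the sup part of the norm sees the
  perturbation.\<close>

lemma mixed_norm_perturb:
  assumes s: "0 < s" and B: "infinite B" and r: "mixed_norm s z < r" and c: "c < 2"
  obtains i q where "i \<in> B" "mixed_norm s (z + single i q) < r" "mixed_norm s (z - single i q) < r"
    "c * r < mixed_norm s (single i q + single i q)"
proof -
  have "0 < r" using mixed_norm_nonneg r by (rule order_le_less_trans)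
  then have "max 0 (c * r / (2 * s)) < r / s"
    using s c by (simp add: field_simps)
  then obtain q where "max 0 (c * r / (2 * s)) < of_rat q" "real_of_rat q < r / s"
    using of_rat_dense by blast
  then have q: "0 < real_of_rat q" "s * of_rat q < r" "c * r < s * (2 * of_rat q)"
    using s by (simp_all add: field_simps)
  have "(\<lambda>i. wt i * of_rat q) \<longlonglongrightarrow> 0 * of_rat q"
    unfolding wt_def by (intro tendsto_mult tendsto_const LIMSEQ_power_zero) simp
  then have "\<forall>\<^sub>F i in sequentially. wt i * of_rat q < r - l1_norm z"
    by (rule order_tendstoD) (use r in \<open>simp add: mixed_norm_def\<close>)
  moreover have "\<forall>\<^sub>F i in sequentially. i \<notin> keys z"
    by (simp flip: cofinite_eq_sequentially add: eventually_cofinite)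
  ultimately have "\<forall>\<^sub>F i in sequentially. wt i * of_rat q < r - l1_norm z \<and> i \<notin> keys z"
    by (rule eventually_conj)
  then obtain i where i: "i \<in> B" "wt i * of_rat q < r - l1_norm z" "i \<notin> keys z"
    using B unfolding eventually_sequentially infinite_nat_iff_unbounded_le by meson
  have "mixed_norm s (z + single i q) < r" "mixed_norm s (z + single i (- q)) < r"
    using q(1,2) i(2) s by (auto intro!: mixed_norm_add_single_less i(3) r simp: of_rat_minus)
  moreover have "c * r < mixed_norm s (single i q + single i q)"
  proof -
    have "s * (2 * of_rat q) = s * \<bar>emb (single i q + single i q) i\<bar>"
      unfolding emb_add emb_single using q(1) by simp
    then show ?thesis
      using q(3) coord_le_mixed_norm[OF less_imp_le[OF s]] by (simp only: order_less_le_trans)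
  qed
  ultimately show ?thesis using i(1) that by (simp add: single_uminus)
qed

definition blk :: "nat \<Rightarrow> nat" where
  "blk i = fst (prod_decode i)"

definition block :: "nat \<Rightarrow> nat set" where
  "block n = {i. blk i = n}"

lemma infinite_block: "infinite (block n)"
proof -
  have "range (\<lambda>m. prod_encode (n, m)) \<subseteq> block n" by (auto simp: block_def blk_def)
  moreover have "infinite (range (\<lambda>m. prod_encode (n, m)))"
    by (intro range_inj_infinite injI) simp
  ultimately show ?thesis by (rule infinite_super)
qed

definition block_sum_norm :: "(nat \<Rightarrow> real) \<Rightarrow> V \<Rightarrow> real" where
  "block_sum_norm t v = (\<Sum>n\<in>blk ` keys v. mixed_norm (t n) (proj (block n) v))"

lemma proj_block_eq_0: "n \<notin> blk ` keys v \<Longrightarrow> proj (block n) v = 0"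
  by (rule proj_eq_0) (auto simp: block_def)

lemma block_sum_norm_eq:
  assumes "finite M" "blk ` keys v \<subseteq> M"
  shows "block_sum_norm t v = (\<Sum>n\<in>M. mixed_norm (t n) (proj (block n) v))"
  unfolding block_sum_norm_def using assms
  by (intro sum.mono_neutral_left) (auto simp: proj_block_eq_0 mixed_norm_zero_right)

lemma sum_proj_block: "(\<Sum>n\<in>blk ` keys v. proj (block n) v) = v"
  by (rule poly_mapping_eqI) (auto simp: lookup_sum block_def in_keys_iff)

lemma block_sum_norm_on_block:
  assumes "keys v \<subseteq> block n"
  shows "block_sum_norm t v = mixed_norm (t n) v"
proof -
  have "block_sum_norm t v = (\<Sum>m\<in>{n}. mixed_norm (t m) (proj (block m) v))"
    using assms by (intro block_sum_norm_eq) (auto simp: block_def)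
  then show ?thesis by (simp add: proj_eq_self[OF assms])
qed

lemma seminormV_block_sum_norm:
  assumes t: "\<And>n. 0 \<le> t n"
  shows "seminormV (block_sum_norm t)"
proof (rule seminormVI)
  interpret mixed: seminorm_on_V "mixed_norm (t n)" for n
    by unfold_locales (rule seminormV_mixed_norm[OF t])
  show "0 \<le> block_sum_norm t v" for v
    unfolding block_sum_norm_def by (simp add: sum_nonneg)
  show "block_sum_norm t (v + w) \<le> block_sum_norm t v + block_sum_norm t w" for v w
  proof -
    let ?M = "blk ` (keys v \<union> keys w)"
    have "block_sum_norm t (v + w) = (\<Sum>n\<in>?M. mixed_norm (t n) (proj (block n) (v + w)))"
      using keys_add[of v w] by (intro block_sum_norm_eq) auto
    also have "\<dots> \<le> (\<Sum>n\<in>?M. mixed_norm (t n) (proj (block n) v)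
        + mixed_norm (t n) (proj (block n) w))"
      unfolding proj_add by (intro sum_mono mixed.triangle)
    also have "\<dots> = block_sum_norm t v + block_sum_norm t w"
      by (simp add: sum.distrib block_sum_norm_eq[of ?M] image_Un)
    finally show ?thesis .
  qed
  show "block_sum_norm t (qscale q v) \<le> \<bar>of_rat q\<bar> * block_sum_norm t v" for q v
  proof -
    have "block_sum_norm t (qscale q v)
        = (\<Sum>n\<in>blk ` keys v. mixed_norm (t n) (proj (block n) (qscale q v)))"
      using keys_qscale by (intro block_sum_norm_eq) auto
    then show ?thesis
      by (simp add: proj_qscale mixed.scale block_sum_norm_def sum_distrib_left)
  qed
qed

lemma mixed_norm_le_block_sum_norm: "mixed_norm (t n) (proj (block n) v) \<le> block_sum_norm t v"
proof -
  have "block_sum_norm t v = (\<Sum>m\<in>insert n (blk ` keys v). mixed_norm (t m) (proj (block m) v))"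
    by (rule block_sum_norm_eq) auto
  also have "mixed_norm (t n) (proj (block n) v) \<le> \<dots>"
    by (rule member_le_sum) (auto simp: mixed_norm_nonneg)
  finally show ?thesis .
qed

lemma coord_le_block_sum_norm: "wt i * \<bar>emb v i\<bar> \<le> block_sum_norm t v"
proof -
  have "wt i * \<bar>emb v i\<bar> = wt i * \<bar>emb (proj (block (blk i)) v) i\<bar>"
    by (simp add: emb_proj block_def)
  also have "\<dots> \<le> l1_norm (proj (block (blk i)) v)" by (rule coord_le_l1_norm)
  also have "\<dots> \<le> mixed_norm (t (blk i)) (proj (block (blk i)) v)" by (rule l1_norm_le_mixed_norm)
  also have "\<dots> \<le> block_sum_norm t v" by (rule mixed_norm_le_block_sum_norm)
  finally show ?thesis .
qed

lemma block_sum_norm_Bset: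
  assumes "\<And>n. 0 \<le> t n"
  shows "block_sum_norm t \<in> Bset"
proof -
  interpret seminorm_on_V "block_sum_norm t"
    by unfold_locales (rule seminormV_block_sum_norm[OF assms])
  show ?thesis using wt_pos coord_le_block_sum_norm by (rule Bset_if_coords_le)
qed

lemma additive_localize_to_block:
  assumes f: "Modules.additive f" and v: "s * block_sum_norm t v < f v"
  obtains n where "s * block_sum_norm t (proj (block n) v) < f (proj (block n) v)"
proof -
  have "(\<Sum>n\<in>blk ` keys v. s * block_sum_norm t (proj (block n) v)) = s * block_sum_norm t v"
    by (simp add: block_sum_norm_on_block[of "proj (block n) v" n for n v] keys_proj
        block_sum_norm_def[of t v] sum_distrib_left)
  also have "\<dots> < f v" by (rule v)
  also have "\<dots> = (\<Sum>n\<in>blk ` keys v. f (proj (block n) v))"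
    by (simp add: sum_proj_block flip: additive.sum[OF f])
  finally show ?thesis using that by (meson not_le sum_mono)
qed

lemma LDP_block_sum_norm:
  assumes t: "\<And>n. 0 < t n" and \<delta>: "\<delta> \<le> 2"
  shows "LDP \<delta> (block_sum_norm t)"
proof -
  interpret seminorm_on_V "block_sum_norm t"
    by unfold_locales (rule seminormV_block_sum_norm[OF less_imp_le[OF t]])
  show ?thesis
  proof (rule LDP_if_perturbable[where Z = "{z. \<exists>n. keys z \<subseteq> block n}", OF _ _ \<delta>])
    show "\<exists>z\<in>{z. \<exists>n. keys z \<subseteq> block n}. s * block_sum_norm t z < f z"
      if f: "Modules.additive f" "s * block_sum_norm t v < f v" for f s v
    proof -
      obtain n where "s * block_sum_norm t (proj (block n) v) < f (proj (block n) v)"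
        using f by (rule additive_localize_to_block)
      moreover have "keys (proj (block n) v) \<subseteq> block n" by (simp add: keys_proj)
      ultimately show ?thesis by blast
    qed
    fix z and r c :: real
    assume "z \<in> {z. \<exists>n. keys z \<subseteq> block n}" and r: "block_sum_norm t z < r" and c: "c < 2"
    then obtain n where z: "keys z \<subseteq> block n" by blast
    have "mixed_norm (t n) z < r" using r by (simp add: block_sum_norm_on_block[OF z])
    then obtain i q where i: "i \<in> block n" and perturb: "mixed_norm (t n) (z + single i q) < r"
      "mixed_norm (t n) (z - single i q) < r" "c * r < mixed_norm (t n) (single i q + single i q)"
      using mixed_norm_perturb[OF t infinite_block _ c] by blast
    have "keys (single i q) \<subseteq> block n" using i by simp
    then have "keys (z + single i q) \<subseteq> block n" "keys (z - single i q) \<subseteq> block n"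
      "keys (single i q + single i q) \<subseteq> block n"
      using z keys_add[of z "single i q"] keys_diff[of z "single i q"]
        keys_add[of "single i q" "single i q"] by blast+
    then show "\<exists>y. block_sum_norm t (z + y) < r \<and> block_sum_norm t (z - y) < r
        \<and> c * r < block_sum_norm t (y + y)"
      using perturb by (intro exI[of _ "single i q"]) (simp add: block_sum_norm_on_block)
  qed
qed

lemma block_sum_norm_L_summand:
  assumes "t (blk i) = 0"
  shows "block_sum_norm t v = block_sum_norm t (proj {i} v) + block_sum_norm t (proj (- {i}) v)"
proof -
  let ?N = "\<lambda>n v. mixed_norm (t n) (proj (block n) v)"
  have split: "?N n v = ?N n (proj {i} v) + ?N n (proj (- {i}) v)" for n
  proof (cases "n = blk i")
    case True
    then show ?thesis
      using l1_norm_split[of "proj (block n) v" "{i}"] assms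
      by (simp add: mixed_norm_zero_left proj_proj Int_commute)
  next
    case False
    then have "block n \<inter> {i} = {}" "block n \<inter> - {i} = block n" by (auto simp: block_def)
    then show ?thesis
      by (simp add: proj_proj proj_eq_0 mixed_norm_zero_right)
  qed
  have "block_sum_norm t (proj A v) = (\<Sum>n\<in>blk ` keys v. ?N n (proj A v))" for A
    by (intro block_sum_norm_eq) (auto simp: keys_proj)
  then show ?thesis
    using split by (simp add: block_sum_norm_def[of t v] flip: sum.distrib)
qed

lemma LDP_block_sum_norm_iff:
  assumes t: "\<And>n. 0 \<le> t n" and \<delta>: "0 < \<delta>" "\<delta> \<le> 2"
  shows "LDP \<delta> (block_sum_norm t) \<longleftrightarrow> (\<forall>n. 0 < t n)"
proof
  interpret seminorm_on_V "block_sum_norm t"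
    by unfold_locales (rule seminormV_block_sum_norm[OF t])
  assume LDP: "LDP \<delta> (block_sum_norm t)"
  show "\<forall>n. 0 < t n"
  proof (rule ccontr)
    assume "\<not> (\<forall>n. 0 < t n)"
    then obtain n where n: "t n = 0" using t by (metis less_eq_real_def)
    obtain i where "i \<in> block n" using infinite_block[of n] by (metis finite.emptyI ex_in_conv)
    then have "t (blk i) = 0" using n by (simp add: block_def)
    moreover have "0 < block_sum_norm t (single i 1)"
      using coord_le_block_sum_norm[of i "single i 1" t] wt_pos[of i] by (simp add: emb_single)
    ultimately show False
      using not_LDP_if_L_summand[OF block_sum_norm_L_summand _ \<delta>(1)] LDP by blast
  qed
qed (simp add: LDP_block_sum_norm \<delta>(2))

subsection \<open>G-delta sets as positivity sets\<close>

context Metric_space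
begin

definition distance_to :: "'a set \<Rightarrow> 'a \<Rightarrow> real" where
  "distance_to F x = (INF y\<in>F. d x y)"

lemma distance_to_le: "y \<in> F \<Longrightarrow> distance_to F x \<le> d x y"
  unfolding distance_to_def by (intro cINF_lower bdd_belowI2[of _ 0]) simp_all

lemma distance_to_greatest: "F \<noteq> {} \<Longrightarrow> (\<And>y. y \<in> F \<Longrightarrow> r \<le> d x y) \<Longrightarrow> r \<le> distance_to F x"
  unfolding distance_to_def by (rule cINF_greatest)

lemma distance_to_Lipschitz:
  assumes F: "F \<noteq> {}" "F \<subseteq> M" and xy: "x \<in> M" "y \<in> M"
  shows "\<bar>distance_to F x - distance_to F y\<bar> \<le> d x y"
proof -
  have "distance_to F x - d x y \<le> distance_to F y" if "x \<in> M" "y \<in> M" for x y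
  proof (rule distance_to_greatest[OF F(1)])
    fix z assume "z \<in> F"
    then show "distance_to F x - d x y \<le> d y z"
      using distance_to_le[of z F x] triangle[of x y z] that F(2) by force
  qed
  from this[OF xy] this[OF xy(2,1)] show ?thesis by (simp add: commute abs_le_iff)
qed

lemma continuous_map_distance_to:
  assumes "F \<noteq> {}" "F \<subseteq> M"
  shows "continuous_map mtopology euclideanreal (distance_to F)"
proof -
  have "Lipschitz_continuous_map (metric (M, d)) euclidean_metric (distance_to F)"
    unfolding Lipschitz_continuous_map_def using distance_to_Lipschitz[OF assms]
    by (intro conjI exI[of _ 1]) (simp_all add: dist_real_def)
  from Lipschitz_continuous_imp_continuous_map[OF this] show ?thesis by simp
qed

lemma distance_to_eq_0_iff:
  assumes F: "F \<noteq> {}" "F \<subseteq> M" and x: "x \<in> M"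
  shows "distance_to F x = 0 \<longleftrightarrow> x \<in> mtopology closure_of F"
proof -
  have "distance_to F x < r \<longleftrightarrow> (\<exists>y\<in>F. y \<in> mball x r)" for r
  proof -
    have "distance_to F x < r \<longleftrightarrow> (\<exists>y\<in>F. d x y < r)"
      unfolding distance_to_def using F(1) by (intro cINF_less_iff bdd_belowI2[of _ 0]) simp_all
    also have "\<dots> \<longleftrightarrow> (\<exists>y\<in>F. y \<in> mball x r)"
      using F(2) x by auto
    finally show ?thesis .
  qed
  then have "x \<in> mtopology closure_of F \<longleftrightarrow> (\<forall>r>0. distance_to F x < r)"
    using x by (simp add: metric_closure_of)
  also have "\<dots> \<longleftrightarrow> distance_to F x \<le> 0"
    by (auto intro: dense_ge less_imp_le order_le_less_trans)
  also have "\<dots> \<longleftrightarrow> distance_to F x = 0"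
    using distance_to_greatest[OF F(1), of 0 x] by auto
  finally show ?thesis ..
qed

end

lemma metrizable_zero_set:
  assumes "metrizable_space X" and F: "closedin X F"
  obtains h :: "'a \<Rightarrow> real" where "continuous_map X euclideanreal h" "\<And>x. 0 \<le> h x"
    "\<And>x. x \<in> topspace X \<Longrightarrow> h x = 0 \<longleftrightarrow> x \<in> F"
proof (cases "F = {}")
  case True
  then show ?thesis using that[of "\<lambda>_. 1"] by simp
next
  case False
  obtain M d where "Metric_space M d" and X: "X = Metric_space.mtopology M d"
    using assms(1) unfolding metrizable_space_def by blast
  then interpret Metric_space M d by simp
  have F_M: "F \<subseteq> M" using closedin_subset[OF F] by (simp add: X)
  have "continuous_map X euclideanreal (distance_to F)"
    using continuous_map_distance_to[OF False F_M] by (simp add: X)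
  moreover have "0 \<le> distance_to F x" for x
    by (rule distance_to_greatest[OF False]) simp
  moreover have "distance_to F x = 0 \<longleftrightarrow> x \<in> F" if "x \<in> topspace X" for x
    using distance_to_eq_0_iff[OF False F_M, of x] that closure_of_closedin[OF F] by (simp add: X)
  ultimately show ?thesis by (rule that)
qed

lemma gdelta_in_positivity_set:
  assumes "metrizable_space X" and C: "gdelta_in X C"
  obtains h :: "nat \<Rightarrow> 'a \<Rightarrow> real" where "\<And>n. continuous_map X euclideanreal (h n)"
    "\<And>n x. 0 \<le> h n x" "C = {x \<in> topspace X. \<forall>n. 0 < h n x}"
proof -
  obtain U where U: "\<And>n::nat. openin X (U n)" "\<Inter>(range U) = C"
    using C unfolding gdelta_in_descending by blast
  have "\<exists>h :: 'a \<Rightarrow> real. continuous_map X euclideanreal h \<and> (\<forall>x. 0 \<le> h x) \<and>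
      (\<forall>x\<in>topspace X. h x = 0 \<longleftrightarrow> x \<in> topspace X - U n)" for n
  proof -
    have "closedin X (topspace X - U n)" using U(1) by blast
    from metrizable_zero_set[OF assms(1) this] show ?thesis by metis
  qed
  then obtain h :: "nat \<Rightarrow> 'a \<Rightarrow> real" where h: "\<And>n. continuous_map X euclideanreal (h n)"
    "\<And>n x. 0 \<le> h n x" "\<And>n x. x \<in> topspace X \<Longrightarrow> h n x = 0 \<longleftrightarrow> x \<in> topspace X - U n"
    by metis
  have "0 < h n x \<longleftrightarrow> x \<in> U n" if "x \<in> topspace X" for n x
    using h(2)[of n x] h(3)[OF that, of n] that by (auto simp: less_le)
  then have "C = {x \<in> topspace X. \<forall>n. 0 < h n x}"
    using U(2) gdelta_in_subset[OF C] by blast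
  with h(1,2) show ?thesis by (rule that)
qed

lemma continuous_map_block_sum_norm:
  assumes "\<And>n. continuous_map X euclideanreal (h n)"
  shows "continuous_map X euclidean (\<lambda>x. block_sum_norm (\<lambda>n. h n x))"
  unfolding euclidean_product_topology[symmetric] continuous_map_componentwise_UNIV
proof
  show "continuous_map X euclideanreal (\<lambda>x. block_sum_norm (\<lambda>n. h n x) v)" for v
    unfolding block_sum_norm_def mixed_norm_def
    by (intro continuous_map_sum continuous_map_real_max continuous_map_real_mult
        continuous_map_const[THEN iffD2] assms) auto
qed

theorem theorem5p3:
  fixes \<delta> :: real and I :: "(V \<Rightarrow> real) set"
  assumes "I \<in> {Pset, Pinf, Bset}"
    and "0 < \<delta>" and "\<delta> \<le> 2"
  shows "Gdelta_complete TYPE('w) (top_of_set I) {\<mu> \<in> I. LDP \<delta> \<mu>}"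
  unfolding Gdelta_complete_def
proof (intro conjI allI impI)
  have I: "I \<subseteq> Pset" "Bset \<subseteq> I" using assms(1) by (auto simp: Bset_def Pinf_def)
  then show "gdelta_in (top_of_set I) {\<mu> \<in> I. LDP \<delta> \<mu>}" by (intro gdelta_LDP)
  fix W :: "'w topology" and C
  assume "Polish_top W \<and> W dim_le 0" and "gdelta_in W C"
  then obtain h :: "nat \<Rightarrow> 'w \<Rightarrow> real" where h: "\<And>n. continuous_map W euclideanreal (h n)"
      "\<And>n w. 0 \<le> h n w" and C: "C = {w \<in> topspace W. \<forall>n. 0 < h n w}"
    using gdelta_in_positivity_set completely_metrizable_imp_metrizable_space
    unfolding Polish_top_def by metis
  let ?g = "\<lambda>w. block_sum_norm (\<lambda>n. h n w)"
  have g_I: "?g w \<in> I" for w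
    using block_sum_norm_Bset[of "\<lambda>n. h n w"] h(2) I(2) by blast
  then have "continuous_map W (top_of_set I) ?g"
    using continuous_map_block_sum_norm[OF h(1)] by (auto simp: continuous_map_in_subtopology)
  moreover have "C = {w \<in> topspace W. ?g w \<in> {\<mu> \<in> I. LDP \<delta> \<mu>}}"
    using g_I LDP_block_sum_norm_iff[OF _ assms(2,3), of "\<lambda>n. h n w" for w] h(2)
    by (simp add: C)
  ultimately show "\<exists>g. continuous_map W (top_of_set I) g \<and>
      C = {w \<in> topspace W. g w \<in> {\<mu> \<in> I. LDP \<delta> \<mu>}}"
    by blast
qed

end
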